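(* Let $K=l_0\,p\,\|b\|_\infty$, let $g\in L^\infty(U)$ satisfy $\|g\|_\infty<\frac1{l_0}\left(\frac1{2^pK}\right)^{\frac1{p-1}}$, choose $0<c_0<1$ and set $\varepsilon_0:=\left(\frac{(1-c_0)^p}{2^pK}\right)^{\frac1{p-1}}$. Let $\{X_j\}_{j\in\mathbb{N}}$ be an independent identically distributed (i.i.d.) sequence of random variables $X_j:\Omega\to\mathcal{M}(U)$. Assume that the admissible set $\mathcal{A}_j$ of $X_j$ (defined in the context) equals $\Omega$ for all $j$, and let $u_j(\cdot,\omega)\in L^\infty(U)$ be the corresponding solution with respect to $X_j(\omega)=\mu_{\omega,j}$ and $g$. Then $\{Z_j\}_{j\in\mathbb{N}}$ given by $Z_j(\omega):=\|u_j(\cdot,\omega)\|_\infty$ is an i.i.d. sequence of random variables, and if $m=\mathbb{E}[\|u_j(\cdot,\omega)\|_\infty]<\infty$ and $\sigma^2:=\mathrm{Var}\,Z_j<\infty$, then, as $k\to+\infty$, $$\sum_{j=1}^k\frac{Z_j-m}{\sigma\sqrt k}\to N(0,1)$$ in distribution.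
   Context: Let $n\ge3$, $p>1$, and let $U\subset\mathbb{R}^n$ be a bounded domain with diameter $d_U$; put $l_0:=\frac{d_U^2}{2(n-2)}$. $(\Omega,\mathcal{F},\mathbb{P})$ is a complete probability space. $\mathcal{M}(U)$ is the space of Radon measures on $U$ of finite total variation, with total variation norm denoted $|\mu|$ and its Borel $\sigma$-algebra; $\mathcal{M}(U)$-valued random variables are Borel measurable maps. $f\in BC(\mathbb{R}^n)$ (bounded continuous real functions) and $b\in L^\infty(U)$ are fixed, with $\|f\|_\infty:=\sup_{\mathbb{R}^n}|f|$ and $\|\cdot\|_\infty$ the essential supremum norm on $L^\infty(U)$. For an $\mathcal{M}(U)$-valued random variable $X$ put $\mu_\omega:=X(\omega)$ and $V_\omega(x):=\int_U f(x-y)\,d\mu_\omega(y)$, $x\in U$. The problem considered is $$-\Delta u+V_\omega(x)u=b(x)u|u|^{p-1}+g(x)\ \text{ in }U,\qquad u=0\ \text{ on }\partial U.$$ $G$ is the Green function of $-\Delta$ in $U$ (zero boundary values), and $H(\varphi)(x):=\int_U G(x,y)\varphi(y)\,dy$ for $\varphi\in L^\infty(U)$. An integral solution of the problem is a function $u\in L^\infty(U)$ satisfying $u=H(g)-H(V_\omega u)+H(bu|u|^{p-1})$. Set $\tau_\omega:=l_0\|f\|_\infty|\mu_\omega|$. Basic existence result: if $\varepsilon>0$ and $\omega\in\Omega$ satisfy $0\le\tau_\omega<1$, $\frac{2^pK\varepsilon^{p-1}}{(1-\tau_\omega)^{p-1}}+\tau_\omega<1$ and $\|g\|_\infty\le\varepsilon/l_0$,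 then there is a unique integral solution $u_\omega=u(\cdot,\omega)\in L^\infty(U)$ with $\|u_\omega\|_\infty\le\frac{2\varepsilon}{1-\tau_\omega}$. The admissible set $\mathcal{A}$ for $X$ is the set of $\omega\in\Omega$ for which the problem has a unique solution $u(\cdot,\omega)$ given by this existence result with $\varepsilon=\varepsilon_0$; $u(\cdot,\omega)$ is then that solution. A sequence of real random variables $Y_k$ converges in distribution to a standard normal, written $Y_k\to N(0,1)$, if $\mathbb{P}(Y_k\le x)\to\frac1{\sqrt{2\pi}}\int_{-\infty}^x e^{-t^2/2}\,dt$ for all $x\in\mathbb{R}$. $\mathrm{Var}$ denotes variance and $\mathbb{E}$ expectation. *)

theory Defs
  imports "HOL-Probability.Probability"
begin

section \<open>The space \<open>L\<^sup>\<infinity>(U)\<close>\<close>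

text \<open>Elements of \<open>L\<^sup>\<infinity>(U)\<close> are represented by functions; equality in \<open>L\<^sup>\<infinity>(U)\<close> is equality almost
  everywhere in \<open>U\<close>.\<close>

definition Linf :: "'a::euclidean_space set \<Rightarrow> ('a \<Rightarrow> real) set" where
  "Linf U = {u \<in> borel_measurable (lebesgue_on U).
     esssup (lebesgue_on U) (\<lambda>x. ereal \<bar>u x\<bar>) < \<infinity>}"

definition Linf_norm :: "'a::euclidean_space set \<Rightarrow> ('a \<Rightarrow> real) \<Rightarrow> real" where
  "Linf_norm U u = real_of_ereal (esssup (lebesgue_on U) (\<lambda>x. ereal \<bar>u x\<bar>))"

section \<open>The Green function\<close>

text \<open>Twice continuously differentiable functions with vanishing Laplacian: \<open>Du\<close> is the gradient
  and \<open>D2u x\<close> the derivative of the gradient at \<open>x\<close>.\<close>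

definition harmonic_in :: "'a::euclidean_space set \<Rightarrow> ('a \<Rightarrow> real) \<Rightarrow> bool" where
  "harmonic_in S u \<longleftrightarrow> (\<exists>Du D2u.
     (\<forall>x\<in>S. (u has_derivative (\<lambda>v. Du x \<bullet> v)) (at x)) \<and>
     (\<forall>x\<in>S. (Du has_derivative D2u x) (at x)) \<and>
     (\<forall>v. continuous_on S (\<lambda>x. D2u x v)) \<and>
     (\<forall>x\<in>S. (\<Sum>e\<in>Basis. D2u x e \<bullet> e) = 0))"

definition subharmonic_in :: "'a::euclidean_space set \<Rightarrow> ('a \<Rightarrow> real) \<Rightarrow> bool" where
  "subharmonic_in S v \<longleftrightarrow> continuous_on S v \<and>
     (\<forall>z r h. 0 < r \<and> cball z r \<subseteq> S \<and> continuous_on (cball z r) h \<and> harmonic_in (ball z r) h \<and>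
        (\<forall>y\<in>sphere z r. v y \<le> h y) \<longrightarrow> (\<forall>y\<in>ball z r. v y \<le> h y))"

definition perron_solution :: "'a::euclidean_space set \<Rightarrow> ('a \<Rightarrow> real) \<Rightarrow> 'a \<Rightarrow> real" where
  "perron_solution U \<phi> y = (SUP v\<in>{v. continuous_on (closure U) v \<and> subharmonic_in U v \<and>
     (\<forall>z\<in>frontier U. v z \<le> \<phi> z)}. v y)"

definition fundamental_solution :: "'a::euclidean_space \<Rightarrow> real" where
  "fundamental_solution x =
     1 / (real DIM('a) * (real DIM('a) - 2) * unit_ball_vol (real DIM('a)) * norm x ^ (DIM('a) - 2))"

text \<open>The corrector is the Perron solution of the Dirichlet problem with boundary values
  \<open>fundamental_solution (x - z)\<close>, which exists for every bounded domain. It is the classical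
  corrector, and \<open>green U x\<close> vanishes continuously on the boundary, whenever the Dirichlet problem
  in \<open>U\<close> is classically solvable; at an irregular boundary point the boundary value is attained in
  the generalized sense only. Only values at distinct points of \<open>U\<close> are meaningful.\<close>

definition green :: "'a::euclidean_space set \<Rightarrow> 'a \<Rightarrow> 'a \<Rightarrow> real" where
  "green U x y =
     fundamental_solution (x - y) - perron_solution U (\<lambda>z. fundamental_solution (x - z)) y"

definition green_op :: "'a::euclidean_space set \<Rightarrow> ('a \<Rightarrow> real) \<Rightarrow> 'a \<Rightarrow> real" where
  "green_op U \<phi> x = (\<integral>y. green U x y * \<phi> y \<partial>lebesgue_on U)"

section \<open>Finite signed Radon measures\<close>

abbreviation borel_sets_in :: "'a::euclidean_space set \<Rightarrow> 'a set set" where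
  "borel_sets_in U \<equiv> sets (restrict_space borel U)"

definition variation :: "'a::euclidean_space set \<Rightarrow> ('a set \<Rightarrow> real) \<Rightarrow> 'a set \<Rightarrow> ennreal" where
  "variation U \<mu> A = (SUP P\<in>{P. finite P \<and> partition_on A P \<and> P \<subseteq> borel_sets_in U}.
     \<Sum>B\<in>P. ennreal \<bar>\<mu> B\<bar>)"

text \<open>Set functions are normalized to be 0 on sets that are not Borel subsets of \<open>U\<close>, so that equal
  measures are equal as functions.\<close>

definition radon_measures :: "'a::euclidean_space set \<Rightarrow> ('a set \<Rightarrow> real) set" where
  "radon_measures U = {\<mu>.
     (\<forall>A. A \<notin> borel_sets_in U \<longrightarrow> \<mu> A = 0) \<and>
     (\<forall>A::nat \<Rightarrow> 'a set. range A \<subseteq> borel_sets_in U \<and> disjoint_family A \<longrightarrow>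
        (\<lambda>i. \<mu> (A i)) sums \<mu> (\<Union>i. A i)) \<and>
     variation U \<mu> U < \<infinity> \<and>
     (\<forall>A\<in>borel_sets_in U. \<forall>e>0. \<exists>C. compact C \<and> C \<subseteq> A \<and> variation U \<mu> (A - C) < ennreal e)}"

definition tv_norm :: "'a::euclidean_space set \<Rightarrow> ('a set \<Rightarrow> real) \<Rightarrow> real" where
  "tv_norm U \<mu> = enn2real (variation U \<mu> U)"

definition radon_borel :: "'a::euclidean_space set \<Rightarrow> ('a set \<Rightarrow> real) measure" where
  "radon_borel U = sigma (radon_measures U)
     {S. openin (Metric_space.mtopology (radon_measures U) (\<lambda>\<mu> \<nu>. tv_norm U (\<lambda>A. \<mu> A - \<nu> A))) S}"

text \<open>Jordan decomposition \<open>\<mu>\<^sup>+ = (|\<mu>| + \<mu>)/2\<close>, \<open>\<mu>\<^sup>- = (|\<mu>| - \<mu>)/2\<close>.\<close>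

definition positive_part :: "'a::euclidean_space set \<Rightarrow> ('a set \<Rightarrow> real) \<Rightarrow> 'a measure" where
  "positive_part U \<mu> = measure_of U (borel_sets_in U)
     (\<lambda>A. ennreal ((enn2real (variation U \<mu> A) + \<mu> A) / 2))"

definition negative_part :: "'a::euclidean_space set \<Rightarrow> ('a set \<Rightarrow> real) \<Rightarrow> 'a measure" where
  "negative_part U \<mu> = measure_of U (borel_sets_in U)
     (\<lambda>A. ennreal ((enn2real (variation U \<mu> A) - \<mu> A) / 2))"

definition radon_integral ::
  "'a::euclidean_space set \<Rightarrow> ('a set \<Rightarrow> real) \<Rightarrow> ('a \<Rightarrow> real) \<Rightarrow> real" where
  "radon_integral U \<mu> h = (\<integral>y. h y \<partial>positive_part U \<mu>) - (\<integral>y. h y \<partial>negative_part U \<mu>)"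

section \<open>The boundary value problem\<close>

definition potential ::
  "'a::euclidean_space set \<Rightarrow> ('a \<Rightarrow>\<^sub>C real) \<Rightarrow> ('a set \<Rightarrow> real) \<Rightarrow> 'a \<Rightarrow> real" where
  "potential U f \<mu> x = radon_integral U \<mu> (\<lambda>y. f (x - y))"

definition integral_solution ::
  "'a::euclidean_space set \<Rightarrow> ('a \<Rightarrow>\<^sub>C real) \<Rightarrow> ('a \<Rightarrow> real) \<Rightarrow> real \<Rightarrow> ('a \<Rightarrow> real) \<Rightarrow>
    ('a set \<Rightarrow> real) \<Rightarrow> ('a \<Rightarrow> real) \<Rightarrow> bool" where
  "integral_solution U f b p g \<mu> u \<longleftrightarrow> u \<in> Linf U \<and>
     (AE x in lebesgue_on U. u x =
        green_op U g x - green_op U (\<lambda>y. potential U f \<mu> y * u y) x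
        + green_op U (\<lambda>y. b y * u y * \<bar>u y\<bar> powr (p - 1)) x)"

definition l0 :: "'a::euclidean_space set \<Rightarrow> real" where
  "l0 U = (diameter U)\<^sup>2 / (2 * (real DIM('a) - 2))"

definition Kconst :: "'a::euclidean_space set \<Rightarrow> ('a \<Rightarrow> real) \<Rightarrow> real \<Rightarrow> real" where
  "Kconst U b p = l0 U * p * Linf_norm U b"

definition tau :: "'a::euclidean_space set \<Rightarrow> ('a \<Rightarrow>\<^sub>C real) \<Rightarrow> ('a set \<Rightarrow> real) \<Rightarrow> real" where
  "tau U f \<mu> = l0 U * norm f * tv_norm U \<mu>"

definition existence_conditions ::
  "'a::euclidean_space set \<Rightarrow> ('a \<Rightarrow>\<^sub>C real) \<Rightarrow> ('a \<Rightarrow> real) \<Rightarrow> real \<Rightarrow> ('a \<Rightarrow> real) \<Rightarrow> real \<Rightarrow>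
    ('a set \<Rightarrow> real) \<Rightarrow> bool" where
  "existence_conditions U f b p g \<epsilon> \<mu> \<longleftrightarrow>
     0 < \<epsilon> \<and> 0 \<le> tau U f \<mu> \<and> tau U f \<mu> < 1 \<and>
     2 powr p * Kconst U b p * \<epsilon> powr (p - 1) / (1 - tau U f \<mu>) powr (p - 1) + tau U f \<mu> < 1 \<and>
     Linf_norm U g \<le> \<epsilon> / l0 U"

definition small_solution ::
  "'a::euclidean_space set \<Rightarrow> ('a \<Rightarrow>\<^sub>C real) \<Rightarrow> ('a \<Rightarrow> real) \<Rightarrow> real \<Rightarrow> ('a \<Rightarrow> real) \<Rightarrow> real \<Rightarrow>
    ('a set \<Rightarrow> real) \<Rightarrow> ('a \<Rightarrow> real) \<Rightarrow> bool" where
  "small_solution U f b p g \<epsilon> \<mu> u \<longleftrightarrow>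
     integral_solution U f b p g \<mu> u \<and> Linf_norm U u \<le> 2 * \<epsilon> / (1 - tau U f \<mu>)"

definition admissible_set ::
  "'w measure \<Rightarrow> 'a::euclidean_space set \<Rightarrow> ('a \<Rightarrow>\<^sub>C real) \<Rightarrow> ('a \<Rightarrow> real) \<Rightarrow> real \<Rightarrow>
    ('a \<Rightarrow> real) \<Rightarrow> real \<Rightarrow> ('w \<Rightarrow> 'a set \<Rightarrow> real) \<Rightarrow> 'w set" where
  "admissible_set P U f b p g \<epsilon> X = {\<omega> \<in> space P.
     existence_conditions U f b p g \<epsilon> (X \<omega>) \<and>
     (\<exists>u. small_solution U f b p g \<epsilon> (X \<omega>) u \<and>
        (\<forall>v. small_solution U f b p g \<epsilon> (X \<omega>) v \<longrightarrow> (AE x in lebesgue_on U. v x = u x)))}"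

section \<open>Probabilistic notions\<close>

text \<open>Measurability of each \<open>X j\<close> is part of \<open>indep_vars\<close>.\<close>

definition iid_sequence :: "'w measure \<Rightarrow> 'b measure \<Rightarrow> (nat \<Rightarrow> 'w \<Rightarrow> 'b) \<Rightarrow> bool" where
  "iid_sequence P N X \<longleftrightarrow> prob_space.indep_vars P (\<lambda>_. N) X UNIV \<and>
     (\<forall>i j. distr P N (X i) = distr P N (X j))"

definition tends_to_std_normal :: "'w measure \<Rightarrow> (nat \<Rightarrow> 'w \<Rightarrow> real) \<Rightarrow> bool" where
  "tends_to_std_normal P Y \<longleftrightarrow> (\<forall>x. (\<lambda>k. measure P {\<omega> \<in> space P. Y k \<omega> \<le> x})
     \<longlonglongrightarrow> 1 / sqrt (2 * pi) * (LBINT t:{..x}. exp (- (t\<^sup>2 / 2))))"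

end

theory Submission
  imports Defs
begin

text \<open>
  Each \<open>Z\<^sub>j\<close> is \<open>F \<circ> X\<^sub>j\<close>, where \<open>F\<close> maps an admissible measure \<open>\<mu>\<close> to the norm of its small solution, so
  everything reduces to continuity of \<open>F\<close> in total variation; the rest is the central limit theorem.
  The Green function satisfies \<open>0 \<le> G(x,y) \<le> \<Phi>(x - y)\<close> by the maximum principle, and
  \<open>\<integral>\<^sub>U \<Phi>(x - y) dy \<le> l\<^sub>0\<close>, so \<open>H\<close> has norm at most \<open>l\<^sub>0\<close> on \<open>L\<^sup>\<infinity>(U)\<close>. Subtracting the fixed point equations of
  two small solutions \<open>u\<close>, \<open>v\<close> for \<open>\<mu>\<close>, \<open>\<nu>\<close>, both of norm at most \<open>R\<close>, gives
  \<open>|u - v| \<le> (\<tau>\<^sub>\<mu> + K R\<^sup>p\<^sup>-\<^sup>1) |u - v| + l\<^sub>0 |f| R |\<mu> - \<nu>|\<close>, and the existence condition makes the factor of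
  \<open>|u - v|\<close> less than 1 for all \<open>\<nu>\<close> near \<open>\<mu>\<close>.
\<close>

section \<open>The fundamental solution and comparison with subharmonic functions\<close>

text \<open>Three obstacles shape the proof. Boundary points of \<open>U\<close> may be irregular,
  so the corrector in \<open>green\<close> is only a supremum of subharmonic functions, which are
  themselves defined by comparison on balls. The bounds on G are therefore proved for each
  competitor separately, without differentiating it. Jordan parts are not additive in the measure,
  so linearity of the potential in the measure rests on the variation being a measure and on an
  identity between six positive measures. Finally, solutions are supplied only for the realized
  measures \<open>X j \<omega>\<close>, a set without known structure, so F is not composed as a
  measurable map. Instead, for each open set of values one open set of measures is built that serves
  all j at once, and it transfers measurability, independence and equality of laws together. The
  contraction has its origin in the factor \<open>2 powr p\<close> of the existence condition: for R
  = 2 \<epsilon> / (1 - \<tau>) the number \<open>K * R powr (p - 1)\<close> is half of the first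
  term there. With \<nu> = \<mu> the estimate also shows that the norm depends on the measure alone,
  whichever representative \<open>u j \<omega>\<close> is.\<close>

lemma fundamental_solution_eq:
  fixes z :: "'a::euclidean_space"
  assumes "DIM('a) \<ge> 3"
  shows "fundamental_solution z =
    1 / (real DIM('a) * (real DIM('a) - 2) * unit_ball_vol (real DIM('a)))
      * (z \<bullet> z) powr ((2 - real DIM('a)) / 2)"
proof (cases "z = 0")
  \<comment> \<open>At the pole both sides are 0, by the conventions 1 / 0 = 0 and
    \<open>0 powr t = 0\<close>.\<close>
  case True
  then show ?thesis using assms by (simp add: fundamental_solution_def)
next
  case False
  have "(z \<bullet> z) powr ((2 - real DIM('a)) / 2) = ((norm z) powr 2) powr ((2 - real DIM('a)) / 2)"
    using False by (simp add: power2_norm_eq_inner)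
  also have "\<dots> = norm z powr (- real (DIM('a) - 2))"
  proof -
    have "2 * ((2 - real DIM('a)) / 2) = - real (DIM('a) - 2)" using assms by (simp add: of_nat_diff)
    then show ?thesis by (simp only: powr_powr)
  qed
  also have "\<dots> = 1 / norm z ^ (DIM('a) - 2)"
    using False by (simp add: powr_minus_divide powr_realpow)
  finally show ?thesis by (simp add: fundamental_solution_def)
qed

text \<open>The Hessian is a rank one part minus a multiple of the identity; their traces,
  \<open>n * s y powr (- n / 2 - 1) * s y\<close> and \<open>n * s y powr (- n / 2)\<close> up to a
  common factor, cancel. The affine term provides the tangent plane of the barrier in
  \<open>subharmonic_le_fundamental_solution\<close>.\<close>

lemma harmonic_in_fundamental_solution_plus_affine:
  fixes x a :: "'a::euclidean_space"
  assumes n: "DIM('a) \<ge> 3" and x: "x \<notin> S"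
  shows "harmonic_in S (\<lambda>y. fundamental_solution (x - y) + (a \<bullet> y + k))"
proof -
  define n where "n = real DIM('a)"
  define c where "c = 1 / (n * (n - 2) * unit_ball_vol n)"
  define s where "s y = (x - y) \<bullet> (x - y)" for y
  define Du where "Du y = (c * (n - 2) * s y powr (- n / 2)) *\<^sub>R (x - y) + a" for y
  define D2u where "D2u y v = (c * (n - 2)) *\<^sub>R
    ((n * s y powr (- n / 2 - 1) * ((x - y) \<bullet> v)) *\<^sub>R (x - y) - s y powr (- n / 2) *\<^sub>R v)" for y v
  have pos: "s y > 0" if "y \<in> S" for y
    using that x by (auto simp: s_def)
  have split: "s y powr (t - 1) = s y powr t / s y" if "y \<in> S" for y t
    using pos[OF that] by (simp add: powr_diff)
  have ds: "(s has_derivative (\<lambda>v. - 2 * ((x - y) \<bullet> v))) (at y)" for y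
    unfolding s_def by (auto intro!: derivative_eq_intros simp: inner_commute algebra_simps)
  have dp: "((\<lambda>y. s y powr t) has_derivative (\<lambda>v. - 2 * t * s y powr (t - 1) * ((x - y) \<bullet> v))) (at y)"
    if "y \<in> S" for y t
    by (rule has_derivative_eq_rhs[OF has_derivative_powr[OF ds has_derivative_const]])
      (use pos[OF that] in \<open>auto simp: split[OF that]\<close>)
  have f: "fundamental_solution (x - y) = c * s y powr ((2 - n) / 2)" for y
    using fundamental_solution_eq[OF n, of "x - y"] by (simp add: c_def s_def n_def)
  have 1: "((\<lambda>y. fundamental_solution (x - y) + (a \<bullet> y + k)) has_derivative (\<lambda>v. Du y \<bullet> v)) (at y)"
    if y: "y \<in> S" for y
  proof -
    have e: "(2 - n) / 2 - 1 = - n / 2" by (simp add: field_simps)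
    show ?thesis
      unfolding f Du_def
      by (rule has_derivative_eq_rhs[OF has_derivative_add[OF has_derivative_mult_right[OF dp[OF y]]
              has_derivative_add[OF has_derivative_inner_right[OF has_derivative_ident] has_derivative_const]]])
        (simp only: e, auto simp: fun_eq_iff inner_add_left algebra_simps, simp add: field_simps)
  qed
  have 2: "(Du has_derivative D2u y) (at y)" if y: "y \<in> S" for y
    unfolding Du_def D2u_def
    by (rule has_derivative_eq_rhs[OF has_derivative_add[OF has_derivative_scaleR[OF
            has_derivative_mult_right[OF dp[OF y]]
            has_derivative_diff[OF has_derivative_const has_derivative_ident]] has_derivative_const]])
      (auto simp: fun_eq_iff algebra_simps)
  have 3: "continuous_on S (\<lambda>y. D2u y v)" for v
    unfolding D2u_def s_def
    by (intro continuous_intros) (use x in auto)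
  have 4: "(\<Sum>e\<in>Basis. D2u y e \<bullet> e) = 0" if y: "y \<in> S" for y
  proof -
    have i: "(\<Sum>e\<in>Basis. ((x - y) \<bullet> e) * ((x - y) \<bullet> e)) = s y"
      unfolding s_def by (rule euclidean_inner[symmetric])
    have "(\<Sum>e\<in>Basis. D2u y e \<bullet> e) = (\<Sum>e\<in>Basis. c * (n - 2) *
       (n * s y powr (- n / 2 - 1) * (((x - y) \<bullet> e) * ((x - y) \<bullet> e)) - s y powr (- n / 2)))"
      by (rule sum.cong) (auto simp: D2u_def inner_diff_left)
    also have "\<dots> = c * (n - 2) * (n * s y powr (- n / 2 - 1) * s y - n * s y powr (- n / 2))"
      unfolding sum_distrib_left[symmetric] sum_subtractf i by (simp add: n_def)
    also have "\<dots> = 0"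
      using pos[OF y] by (simp add: split[OF y])
    finally show ?thesis .
  qed
  show ?thesis
    unfolding harmonic_in_def
    by (rule exI[of _ Du], rule exI[of _ D2u]) (use 1 2 3 4 in blast)
qed

text \<open>The second derivative is known at 0 only, so the mean value theorem replaces a Taylor
  expansion: l < 0 and \<phi>' 0 = 0 make \<phi>' negative just to the right of 0, and \<phi> would
  fall below \<phi> 0.\<close>

lemma second_derivative_nonneg_at_local_min:
  fixes \<phi> \<phi>' :: "real \<Rightarrow> real"
  assumes "\<rho> > 0" and d: "\<And>t. \<bar>t\<bar> < \<rho> \<Longrightarrow> (\<phi> has_real_derivative \<phi>' t) (at t)"
    and d2: "(\<phi>' has_real_derivative l) (at 0)"
    and min: "\<And>t. \<bar>t\<bar> < \<rho> \<Longrightarrow> \<phi> 0 \<le> \<phi> t"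
  shows "l \<ge> 0"
proof (rule ccontr)
  assume "\<not> l \<ge> 0"
  then obtain e where e: "e > 0" "\<And>h. 0 < h \<Longrightarrow> h < e \<Longrightarrow> \<phi>' (0 + h) < \<phi>' 0"
    using DERIV_neg_dec_right[OF d2] by force
  have z: "\<phi>' 0 = 0"
    by (rule DERIV_local_min[OF d \<open>\<rho> > 0\<close>]) (use assms in auto)
  define s where "s = min \<rho> e / 2"
  have s: "0 < s" "s < \<rho>" "s < e" using e \<open>\<rho> > 0\<close> by (auto simp: s_def)
  obtain t where t: "0 < t" "t < s" "\<phi> s - \<phi> 0 = (s - 0) * \<phi>' t"
    using MVT2[of 0 s \<phi> \<phi>'] d s by auto
  have "\<phi>' t < 0" using e(2)[of t] t s z by auto
  then have "\<phi> s < \<phi> 0" using t(3) s(1) mult_pos_neg[of s "\<phi>' t"] by simp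
  then show False using min[of s] s by auto
qed

text \<open>Weak minimum principle. Adding
  \<open>\<delta> * (r\<^sup>2 - (x - z) \<bullet> (x - z))\<close> leaves the values on the sphere
  unchanged and makes the Laplacian the negative constant \<open>- 2 * \<delta> * DIM('a)\<close>.
  At an interior minimum all second derivatives along the coordinate axes would be
  nonnegative.\<close>

lemma harmonic_in_ball_nonneg:
  fixes h :: "'a::euclidean_space \<Rightarrow> real"
  assumes c: "continuous_on (cball z r) h" and h: "harmonic_in (ball z r) h"
    and b: "\<And>y. y \<in> sphere z r \<Longrightarrow> 0 \<le> h y" and y: "y \<in> ball z r"
  shows "0 \<le> h y"
proof (rule ccontr)
  assume neg: "\<not> 0 \<le> h y"
  obtain Du D2u where
    D1: "\<And>x. x \<in> ball z r \<Longrightarrow> (h has_derivative (\<lambda>v. Du x \<bullet> v)) (at x)" and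
    D2: "\<And>x. x \<in> ball z r \<Longrightarrow> (Du has_derivative D2u x) (at x)" and
    D3: "\<And>x. x \<in> ball z r \<Longrightarrow> (\<Sum>e\<in>Basis. D2u x e \<bullet> e) = 0"
    using h unfolding harmonic_in_def by (elim exE conjE) blast
  have r: "r > 0" using y by (auto intro: order.strict_trans1[OF zero_le_dist])
  \<comment> \<open>Chosen so that \<open>\<delta> * r\<^sup>2 = - h y / 2\<close>: the perturbation
    cannot lift the negative value at y beyond \<open>h y / 2\<close>.\<close>
  define \<delta> where "\<delta> = - h y / (2 * r\<^sup>2)"
  have \<delta>: "\<delta> > 0" using neg r by (simp add: \<delta>_def field_simps)
  define w where "w x = h x + \<delta> * (r\<^sup>2 - (x - z) \<bullet> (x - z))" for x
  have "continuous_on (cball z r) w"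
    unfolding w_def by (intro continuous_intros c)
  moreover have "cball z r \<noteq> {}" using r by auto
  ultimately obtain y0 where y0: "y0 \<in> cball z r" "\<And>x. x \<in> cball z r \<Longrightarrow> w y0 \<le> w x"
    using continuous_attains_inf[of "cball z r" w] by auto
  have "w y0 \<le> w y" using y0(2) y by auto
  also have "w y \<le> h y + \<delta> * r\<^sup>2" unfolding w_def using \<delta> by (simp add: mult_left_mono)
  also have "\<dots> = h y / 2" using r by (simp add: \<delta>_def field_simps)
  also have "\<dots> < 0" using neg by simp
  finally have "w y0 < 0" .
  moreover have "w x \<ge> 0" if "x \<in> sphere z r" for x
  proof -
    have "(x - z) \<bullet> (x - z) = r\<^sup>2"
      using that by (simp add: power2_norm_eq_inner[symmetric] dist_norm norm_minus_commute)
    then show ?thesis using b[OF that] by (simp add: w_def)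
  qed
  ultimately have "y0 \<notin> sphere z r" by (meson not_less)
  then have y0b: "y0 \<in> ball z r" using y0(1) by simp
  then obtain \<rho> where \<rho>: "\<rho> > 0" "ball y0 \<rho> \<subseteq> ball z r"
    using open_ball openE by blast
  have nn: "D2u y0 e \<bullet> e - 2 * \<delta> \<ge> 0" if e: "e \<in> Basis" for e
  proof (rule second_derivative_nonneg_at_local_min[OF \<rho>(1)])
    let ?\<phi> = "\<lambda>t. w (y0 + t *\<^sub>R e)"
    let ?\<phi>' = "\<lambda>t. Du (y0 + t *\<^sub>R e) \<bullet> e - 2 * \<delta> * ((y0 + t *\<^sub>R e - z) \<bullet> e)"
    have ib: "y0 + t *\<^sub>R e \<in> ball z r" if "\<bar>t\<bar> < \<rho>" for t
      using \<rho>(2) that e by (auto simp: subset_eq dist_norm)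
    have line: "((\<lambda>t. y0 + t *\<^sub>R e) has_derivative (\<lambda>s. s *\<^sub>R e)) (at t)" for t
      by (auto intro!: derivative_eq_intros)
    have q: "((\<lambda>t. \<delta> * (r\<^sup>2 - (y0 + t *\<^sub>R e - z) \<bullet> (y0 + t *\<^sub>R e - z))) has_derivative
        (\<lambda>s. s * (- 2 * \<delta> * ((y0 + t *\<^sub>R e - z) \<bullet> e)))) (at t)" for t
    proof -
      have l: "((\<lambda>t. y0 + t *\<^sub>R e - z) has_derivative (\<lambda>s. s *\<^sub>R e)) (at t)"
        using has_derivative_diff[OF line has_derivative_const] by simp
      show ?thesis
        by (rule has_derivative_eq_rhs[OF has_derivative_mult_right[OF
                has_derivative_diff[OF has_derivative_const has_derivative_inner[OF l l]]]])
          (simp add: fun_eq_iff inner_commute[of e])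
    qed
    show "(?\<phi> has_real_derivative ?\<phi>' t) (at t)" if "\<bar>t\<bar> < \<rho>" for t
      unfolding w_def has_field_derivative_def
      by (rule has_derivative_eq_rhs[OF has_derivative_add[OF
              has_derivative_compose[OF line D1[OF ib[OF that]]] q]])
        (auto simp: fun_eq_iff algebra_simps)
    have d2: "((\<lambda>t. Du (y0 + t *\<^sub>R e)) has_derivative (\<lambda>s. D2u y0 (s *\<^sub>R e))) (at 0)"
      using has_derivative_compose[OF line[of 0], of Du "D2u y0"] D2[OF y0b] by simp
    have lin: "D2u y0 (s *\<^sub>R e) = s *\<^sub>R D2u y0 e" for s
      using D2[OF y0b] by (simp add: has_derivative_bounded_linear linear_simps(5))
    have q': "((\<lambda>t. 2 * \<delta> * ((y0 + t *\<^sub>R e - z) \<bullet> e)) has_derivative (\<lambda>s. 2 * \<delta> * s)) (at 0)"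
      using e by (auto intro!: derivative_eq_intros)
    show "(?\<phi>' has_real_derivative D2u y0 e \<bullet> e - 2 * \<delta>) (at 0)"
      unfolding has_field_derivative_def
      by (rule has_derivative_eq_rhs[OF has_derivative_diff[OF has_derivative_inner_left[OF d2] q']])
        (auto simp: fun_eq_iff algebra_simps lin)
    show "?\<phi> 0 \<le> ?\<phi> t" if "\<bar>t\<bar> < \<rho>" for t
      using y0(2)[of "y0 + t *\<^sub>R e"] ib[OF that] by auto
  qed
  have "0 \<le> (\<Sum>e\<in>(Basis::'a set). D2u y0 e \<bullet> e - 2 * \<delta>)" by (rule sum_nonneg) (rule nn)
  also have "\<dots> = - (2 * \<delta> * real DIM('a))"
    unfolding sum_subtractf D3[OF y0b] by simp
  finally show False using \<delta> by (simp add: mult_le_0_iff)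
qed

lemma subharmonic_in_zero: "subharmonic_in S (\<lambda>_. 0)"
  unfolding subharmonic_in_def
  by (intro conjI allI impI ballI continuous_on_const, rule harmonic_in_ball_nonneg) auto

lemma continuous_on_fundamental_solution:
  assumes "DIM('a::euclidean_space) \<ge> 3" "(x::'a) \<notin> S"
  shows "continuous_on S (\<lambda>y. fundamental_solution (x - y))"
  unfolding fundamental_solution_eq[OF assms(1)]
  by (intro continuous_intros) (use assms in auto)

lemma fundamental_solution_nonneg:
  assumes "DIM('a::euclidean_space) \<ge> 3"
  shows "0 \<le> fundamental_solution (z::'a)"
  using assms unfolding fundamental_solution_def by simp

text \<open>Maximum principle for \<open>v - ?F\<close> on U with a small ball around the pole
  removed. As v need not be differentiable, a positive maximum is refuted by a harmonic function
  that dominates v on a small sphere around the maximum point but not at its centre.\<close>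

lemma subharmonic_le_fundamental_solution:
  fixes U :: "'a::euclidean_space set"
  assumes n: "DIM('a) \<ge> 3" and U: "open U" "bounded U" and x: "x \<in> U"
    and v: "continuous_on (closure U) v" "subharmonic_in U v"
    and vb: "\<And>z. z \<in> frontier U \<Longrightarrow> v z \<le> fundamental_solution (x - z)"
    and y: "y \<in> U" "y \<noteq> x"
  shows "v y \<le> fundamental_solution (x - y)"
proof (rule ccontr)
  let ?F = "\<lambda>z. fundamental_solution (x - z) :: real"
  assume "\<not> v y \<le> ?F y"
  define \<eta> where "\<eta> = v y - ?F y"
  have \<eta>: "\<eta> > 0" using \<open>\<not> v y \<le> ?F y\<close> by (simp add: \<eta>_def)
  have cU: "compact (closure U)" using U by (simp add: compact_closure)
  have "bounded (v ` closure U)"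
    by (rule compact_imp_bounded[OF compact_continuous_image[OF v(1) cU]])
  then obtain B where B: "B > 0" "\<And>z. z \<in> closure U \<Longrightarrow> v z \<le> B"
    by (auto simp: bounded_pos) (metis abs_le_D1)
  have "bounded (closure U)" using cU by (rule compact_imp_bounded)
  then obtain D where D: "D > 0" "\<And>z. z \<in> closure U \<Longrightarrow> dist x z \<le> D"
    by (metis bounded_any_center linorder_not_le less_le_trans zero_less_one
        less_eq_real_def)
  define c where "c = 1 / (real DIM('a) * (real DIM('a) - 2) * unit_ball_vol (real DIM('a)))"
  have c: "c > 0" using n unfolding c_def by simp
  \<comment> \<open>On the sphere of radius \<rho> the singularity already dominates v: \<rho> \<le>
    1 and \<open>DIM('a) - 2 \<ge> 1\<close> give
    \<open>c / \<rho> ^ (DIM('a) - 2) \<ge> c / \<rho> \<ge> B\<close>. The bound by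
    \<open>dist x y\<close> keeps y outside the removed open ball.\<close>
  define \<rho> where "\<rho> = min (min 1 (dist x y)) (c / B)"
  have \<rho>: "\<rho> > 0" "\<rho> \<le> 1" "\<rho> \<le> dist x y" "\<rho> \<le> c / B"
    using c B y by (auto simp: \<rho>_def)
  have near: "B \<le> ?F z" if "dist x z = \<rho>" for z
  proof -
    have "?F z = c / \<rho> ^ (DIM('a) - 2)"
      using that by (simp add: fundamental_solution_def c_def dist_norm)
    moreover have "\<rho> ^ (DIM('a) - 2) \<le> \<rho> ^ 1"
      by (rule power_decreasing) (use n \<rho> in auto)
    then have "c / \<rho> \<le> c / \<rho> ^ (DIM('a) - 2)"
      using c \<rho> by (intro divide_left_mono) auto
    moreover have "B \<le> c / \<rho>" using \<rho> B by (simp add: field_simps)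
    ultimately show ?thesis by simp
  qed
  \<comment> \<open>The quadratic term is at most \<eta> / 2 on the closure of U, so w stays below
    \<eta> wherever v \<le> \<open>?F\<close>. Since w reaches \<eta> at y, its maximum lies neither
    on the frontier nor on the sphere of radius \<rho>.\<close>
  define \<delta> where "\<delta> = \<eta> / (2 * D\<^sup>2)"
  have \<delta>: "\<delta> > 0" using \<eta> D by (simp add: \<delta>_def)
  define C where "C = closure U - ball x \<rho>"
  have C: "compact C" unfolding C_def by (intro compact_diff cU) auto
  have yC: "y \<in> C" using y \<rho> closure_subset[of U] by (auto simp: C_def)
  define w where "w z = v z - ?F z + \<delta> * ((z - x) \<bullet> (z - x))" for z
  have "continuous_on C w"
    unfolding w_def
    by (intro continuous_intros continuous_on_fundamental_solution n continuous_on_subset[OF v(1)])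
      (use \<rho> in \<open>auto simp: C_def\<close>)
  then obtain y0 where y0: "y0 \<in> C" "\<And>z. z \<in> C \<Longrightarrow> w z \<le> w y0"
    using continuous_attains_sup[OF C] yC by blast
  have "\<eta> \<le> w y" using \<delta> by (simp add: w_def \<eta>_def)
  also have "\<dots> \<le> w y0" by (rule y0(2)[OF yC])
  finally have w0: "\<eta> \<le> w y0" .
  have low: "w z < \<eta>" if "z \<in> C" "v z \<le> ?F z" for z
  proof -
    have "(z - x) \<bullet> (z - x) = (dist x z)\<^sup>2"
      by (subst dist_commute) (simp add: dist_norm power2_norm_eq_inner)
    also have "\<dots> \<le> D\<^sup>2" using D(2)[of z] that(1) by (auto simp: C_def intro: power_mono)
    finally have "\<delta> * ((z - x) \<bullet> (z - x)) \<le> \<delta> * D\<^sup>2" using \<delta> by simp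
    also have "\<dots> < \<eta>" using \<eta> D by (simp add: \<delta>_def)
    finally show ?thesis using that by (simp add: w_def)
  qed
  have y0n: "\<not> v y0 \<le> ?F y0" using low[OF y0(1)] w0 by auto
  then have "y0 \<notin> frontier U" using vb by blast
  then have y0U: "y0 \<in> U" using y0(1) U by (auto simp: C_def frontier_def interior_open)
  have "dist x y0 \<noteq> \<rho>" using y0n near[of y0] B(2)[of y0] y0(1) by (force simp: C_def)
  then have "y0 \<in> U - cball x \<rho>" using y0U y0(1) by (auto simp: C_def)
  moreover have "open (U - cball x \<rho>)" using U by (intro open_Diff) auto
  ultimately obtain r where r: "r > 0" "cball y0 r \<subseteq> U - cball x \<rho>"
    by (meson open_contains_cball)
  \<comment> \<open>Replacing the quadratic perturbation by its tangent plane minus \<open>\<delta> r\<^sup>2\<close> keeps its values on the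
    sphere and makes the upper barrier harmonic.\<close>
  define h where "h z = ?F z + ((- 2 * \<delta>) *\<^sub>R (y0 - x) \<bullet> z +
    (v y0 - ?F y0 + 2 * \<delta> * ((y0 - x) \<bullet> y0) - \<delta> * r\<^sup>2))" for z
  have xn: "x \<notin> cball y0 r" using r \<rho> by auto
  have "harmonic_in (ball y0 r) h" unfolding h_def
    by (rule harmonic_in_fundamental_solution_plus_affine[OF n]) (use xn in auto)
  moreover have "continuous_on (cball y0 r) h" unfolding h_def
    by (intro continuous_intros continuous_on_fundamental_solution n xn)
  moreover have "v z \<le> h z" if z: "z \<in> sphere y0 r" for z
  proof -
    have "z \<in> C" using z r(2) closure_subset[of U] by (force simp: C_def subset_eq)
    then have "w z \<le> w y0" by (rule y0(2))
    moreover have "(z - y0) \<bullet> (z - y0) = r\<^sup>2"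
      using z by (simp add: power2_norm_eq_inner[symmetric] dist_norm norm_minus_commute)
    then have "(z - x) \<bullet> (z - x) = (y0 - x) \<bullet> (y0 - x) + 2 * ((y0 - x) \<bullet> (z - y0)) + r\<^sup>2"
      by (simp add: algebra_simps inner_commute)
    then have "\<delta> * ((z - x) \<bullet> (z - x)) =
        \<delta> * ((y0 - x) \<bullet> (y0 - x)) + 2 * \<delta> * ((y0 - x) \<bullet> z - (y0 - x) \<bullet> y0) + \<delta> * r\<^sup>2"
      by (simp only: distrib_left inner_diff_right)
    ultimately show ?thesis by (simp add: w_def h_def right_diff_distrib)
  qed
  moreover have "cball y0 r \<subseteq> U" using r by auto
  ultimately have "v y0 \<le> h y0"
    using v(2) r(1) unfolding subharmonic_in_def by (metis centre_in_ball)
  moreover have "\<delta> * r\<^sup>2 > 0" using \<delta> r(1) by simp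
  ultimately show False by (simp add: h_def)
qed

section \<open>The Green operator\<close>

text \<open>The zero function competes because the boundary values are nonnegative, and comparison
  bounds every competitor from above. The supremum is thus over a nonempty bounded set, as suprema
  of reals require. The pole is left out because \<open>fundamental_solution 0\<close> is 0, so no
  upper bound holds there.\<close>

lemma perron_bounds:
  fixes U :: "'a::euclidean_space set"
  assumes n: "DIM('a) \<ge> 3" and U: "open U" "bounded U" and x: "x \<in> U"
  defines "V \<equiv> {v. continuous_on (closure U) v \<and> subharmonic_in U v \<and>
     (\<forall>z\<in>frontier U. v z \<le> fundamental_solution (x - z))}"
  shows "(\<lambda>_. 0) \<in> V"
    and "y \<in> U - {x} \<Longrightarrow> bdd_above ((\<lambda>v. v y) ` V)"
    and "y \<in> U - {x} \<Longrightarrow> 0 \<le> perron_solution U (\<lambda>z. fundamental_solution (x - z)) y"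
    and "y \<in> U - {x} \<Longrightarrow>
      perron_solution U (\<lambda>z. fundamental_solution (x - z)) y \<le> fundamental_solution (x - y)"
proof -
  show 0: "(\<lambda>_. 0) \<in> V"
    using fundamental_solution_nonneg[OF n] by (auto simp: V_def subharmonic_in_zero)
  have le: "v y \<le> fundamental_solution (x - y)" if "v \<in> V" "y \<in> U - {x}" for v y
    using subharmonic_le_fundamental_solution[OF n U x, of v y] that by (auto simp: V_def)
  show bdd: "bdd_above ((\<lambda>v. v y) ` V)" if "y \<in> U - {x}" for y
    using le[OF _ that] by (rule bdd_aboveI2)
  have eq: "perron_solution U (\<lambda>z. fundamental_solution (x - z)) y = (SUP v\<in>V. v y)" for y
    by (simp add: perron_solution_def V_def)
  show "0 \<le> perron_solution U (\<lambda>z. fundamental_solution (x - z)) y" if "y \<in> U - {x}"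
    unfolding eq using cSUP_upper[OF 0 bdd[OF that]] by simp
  show "perron_solution U (\<lambda>z. fundamental_solution (x - z)) y \<le> fundamental_solution (x - y)"
    if "y \<in> U - {x}"
    unfolding eq by (rule cSUP_least) (use 0 le[OF _ that] in auto)
qed

lemma green_bounds:
  fixes U :: "'a::euclidean_space set"
  assumes "DIM('a) \<ge> 3" "open U" "bounded U" "x \<in> U" "y \<in> U" "y \<noteq> x"
  shows "0 \<le> green U x y" and "green U x y \<le> fundamental_solution (x - y)"
  using perron_bounds(3,4)[OF assms(1-4), of y] assms(5,6) by (auto simp: green_def)

section \<open>Measurability of the Green function and integrals of its upper bound\<close>

lemma borel_measurable_fundamental_solution[measurable]:
  "fundamental_solution \<in> borel_measurable borel"
  unfolding fundamental_solution_def[abs_def] by measurable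

lemma borel_measurable_lebesgue_onI:
  fixes f :: "'a::euclidean_space \<Rightarrow> real"
  assumes "f \<in> borel_measurable borel"
  shows "f \<in> borel_measurable (lebesgue_on U)"
  using assms by (intro measurable_restrict_space1 measurable_completion) simp

text \<open>The Perron supremum is uncountable, but a supremum of continuous functions is lower
  semicontinuous: its superlevel sets in \<open>U - {x}\<close> are unions of open sets. The pole,
  where the family is not controlled, adds at most one point.\<close>

lemma borel_measurable_green:
  fixes U :: "'a::euclidean_space set"
  assumes n: "DIM('a) \<ge> 3" and U: "open U" "bounded U" and x: "x \<in> U"
  shows "green U x \<in> borel_measurable (lebesgue_on U)"
proof -
  define V where "V = {v. continuous_on (closure U) v \<and> subharmonic_in U v \<and>
     (\<forall>z\<in>frontier U. v z \<le> fundamental_solution (x - z))}"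
  define h where "h = perron_solution U (\<lambda>z. fundamental_solution (x - z))"
  have h: "h y = (SUP v\<in>V. v y)" for y
    by (simp add: h_def perron_solution_def V_def)
  have "{y \<in> space (lebesgue_on U). a < h y} \<in> sets (lebesgue_on U)" for a
  proof -
    have "{y \<in> U - {x}. a < h y} = (\<Union>v\<in>V. {y \<in> U - {x}. a < v y})"
      unfolding h using less_cSUP_iff[OF _ perron_bounds(2)[OF n U x]] perron_bounds(1)[OF n U x]
      unfolding V_def[symmetric] by blast
    also have "open \<dots>"
    proof (intro open_UN ballI)
      fix v assume "v \<in> V"
      then have "continuous_on (U - {x}) v"
        using closure_subset[of U] by (auto simp: V_def intro: continuous_on_subset)
      moreover have "open (U - {x})" using U by auto
      ultimately have "open (v -` {a<..} \<inter> (U - {x}))"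
        using open_greaterThan continuous_on_open_vimage by blast
      moreover have "{y \<in> U - {x}. a < v y} = v -` {a<..} \<inter> (U - {x})" by auto
      ultimately show "open {y \<in> U - {x}. a < v y}" by simp
    qed
    finally have op: "open {y \<in> U - {x}. a < h y}" .
    have "{y \<in> U. a < h y} = {y \<in> U - {x}. a < h y} \<union> (if a < h x then {x} else {})"
      using x by auto
    also have "\<dots> \<in> sets lebesgue" using op by (auto simp: lborelD borel_open)
    finally show ?thesis
      using U by (subst sets_restrict_space_iff) (auto simp: lborelD borel_open space_restrict_space)
  qed
  then have "h \<in> borel_measurable (lebesgue_on U)"
    by (simp add: borel_measurable_iff_greater)
  moreover have "(\<lambda>y. fundamental_solution (x - y)) \<in> borel_measurable (lebesgue_on U)"
    by (rule borel_measurable_lebesgue_onI) measurable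
  ultimately show ?thesis
    unfolding green_def[abs_def] h_def[symmetric] by measurable
qed

text \<open>Integrating \<open>r\<^sup>-\<^sup>k = d\<^sup>-\<^sup>k + k \<integral>\<^sub>r\<^sup>d s\<^sup>-\<^sup>k\<^sup>-\<^sup>1 ds\<close> over the ball and exchanging the integrals replaces polar
  coordinates by the volume formula for balls.\<close>

lemma nn_integral_fundamental_solution_cball:
  fixes x :: "'a::euclidean_space"
  assumes n: "DIM('a) \<ge> 3" and d: "d > 0"
  shows "(\<integral>\<^sup>+y. ennreal (fundamental_solution (x - y)) * indicator (cball x d) y \<partial>lborel)
    \<le> ennreal (d\<^sup>2 / (2 * (real DIM('a) - 2)))"
proof -
  define N where "N = DIM('a)"
  define k where "k = N - 2"
  have k: "k \<ge> 1" "N = k + 2" using n by (auto simp: k_def N_def)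
  define \<omega> where "\<omega> = unit_ball_vol (real N)"
  have \<omega>: "\<omega> > 0" by (simp add: \<omega>_def)
  define c where "c = 1 / (real N * real k * \<omega>)"
  have c: "c \<ge> 0" using \<omega> by (simp add: c_def)
  have Phi: "fundamental_solution (x - y) = c * (1 / dist x y ^ k)" for y
    using n by (simp add: fundamental_solution_def c_def N_def k_def \<omega>_def dist_norm of_nat_diff)
  define q where "q s = real k / s ^ (k + 1)" for s :: real
  have q0: "q s \<ge> 0" if "s \<ge> 0" for s using that by (simp add: q_def)
  have FTC: "ennreal (1 / r ^ k) = ennreal (1 / d ^ k) + (\<integral>\<^sup>+s. ennreal (q s) * indicator {r..d} s \<partial>lborel)"
    if r: "0 < r" "r \<le> d" for r
  proof -
    have "(\<integral>\<^sup>+s. ennreal (q s) * indicator {r..d} s \<partial>lborel) = ennreal (- 1 / d ^ k - (- 1 / r ^ k))"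
    proof (rule nn_integral_FTC_Icc[where F = "\<lambda>s. - 1 / s ^ k"])
      show "q \<in> borel_measurable borel" unfolding q_def by measurable
      show "((\<lambda>s. - 1 / s ^ k) has_real_derivative q s) (at s)" if "s \<in> {r..d}" for s
      proof -
        have s: "s > 0" using that r by auto
        obtain j where j: "k = Suc j" using k by (cases k) auto
        have "((\<lambda>s. - 1 / s ^ k) has_real_derivative
            - (- 1 * (real k * s ^ (k - 1))) / (s ^ k * s ^ k)) (at s)"
          using s by (auto intro!: derivative_eq_intros)
        also have "- (- 1 * (real k * s ^ (k - 1))) / (s ^ k * s ^ k) = q s"
          using s by (simp add: q_def j field_simps)
        finally show ?thesis .
      qed
    qed (use r q0 in auto)
    moreover have "1 / d ^ k \<le> 1 / r ^ k" using r by (intro divide_left_mono power_mono) auto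
    ultimately show ?thesis using d by (simp flip: ennreal_plus)
  qed
  have [measurable]: "q \<in> borel_measurable borel" unfolding q_def by measurable
  \<comment> \<open>The range \<open>dist x y \<le> s \<le> d\<close> is coded by two indicators:
    integration in s for fixed y gives the tail integral of q, and integration in y for fixed s the
    volume of a ball.\<close>
  define j where "j y s = ennreal (q s) * (indicator {0..d} s * indicator (cball x s) y)" for y s
  have "(\<lambda>(y, s). j y s) = (\<lambda>(y, s). if 0 \<le> s \<and> s \<le> d \<and> dist x y \<le> s then ennreal (q s) else 0)"
    by (auto simp: fun_eq_iff j_def)
  also have "\<dots> \<in> borel_measurable (lborel \<Otimes>\<^sub>M lborel)" by measurable
  finally have jm[measurable]: "(\<lambda>(y, s). j y s) \<in> borel_measurable (lborel \<Otimes>\<^sub>M lborel)" .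
  have "(\<integral>\<^sup>+y. ennreal (1 / dist x y ^ k) * indicator (cball x d) y \<partial>lborel)
     \<le> (\<integral>\<^sup>+y. ennreal (1 / d ^ k) * indicator (cball x d) y
          + (\<integral>\<^sup>+s. j y s \<partial>lborel) \<partial>lborel)"
  proof (rule nn_integral_mono)
    fix y
    show "ennreal (1 / dist x y ^ k) * indicator (cball x d) y \<le>
      ennreal (1 / d ^ k) * indicator (cball x d) y
          + (\<integral>\<^sup>+s. j y s \<partial>lborel)"
    proof (cases "y \<in> cball x d \<and> y \<noteq> x")
      case True
      have "(\<integral>\<^sup>+s. j y s \<partial>lborel)
        = (\<integral>\<^sup>+s. ennreal (q s) * indicator {dist x y..d} s \<partial>lborel)"
        by (rule nn_integral_cong) (auto simp: j_def indicator_def intro: order.trans[OF zero_le_dist])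
      then show ?thesis using True FTC[of "dist x y"] by auto
    next
      \<comment> \<open>For y = x the left side is 0, since 1 / 0 = 0 and k \<ge> 1; outside the
        ball the indicator vanishes.\<close>
      case False
      then show ?thesis using k by (auto simp: indicator_def zero_power)
    qed
  qed
  also have "\<dots> = ennreal (1 / d ^ k) * emeasure lborel (cball x d)
      + (\<integral>\<^sup>+y. (\<integral>\<^sup>+s. j y s \<partial>lborel) \<partial>lborel)"
    by (subst nn_integral_add) (auto simp: nn_integral_cmult_indicator borel_closed
        intro!: borel_measurable_times_ennreal borel_measurable_indicator)
  also have "(\<integral>\<^sup>+y. (\<integral>\<^sup>+s. j y s \<partial>lborel) \<partial>lborel)
    = (\<integral>\<^sup>+s. (\<integral>\<^sup>+y. j y s \<partial>lborel) \<partial>lborel)"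
    by (rule lborel_pair.Fubini'[symmetric]) (rule jm)
  also have "\<dots> = (\<integral>\<^sup>+s. ennreal (real k * \<omega> * s) * indicator {0..d} s \<partial>lborel)"
  proof (rule nn_integral_cong)
    fix s
    have "(\<integral>\<^sup>+y. j y s \<partial>lborel) =
        ennreal (q s) * indicator {0..d} s * emeasure lborel (cball x s)"
      unfolding j_def by (subst mult.assoc[symmetric], subst nn_integral_cmult_indicator) auto
    also have "\<dots> = ennreal (real k * \<omega> * s) * indicator {0..d} s"
    proof (cases "s \<in> {0..d}")
      case True
      have "q s * (\<omega> * s ^ N) = real k * \<omega> * s"
        using True k by (cases "s = 0") (auto simp: q_def field_simps)
      then show ?thesis using True q0[of s] \<omega>
        by (simp add: emeasure_cball N_def[symmetric] \<omega>_def[symmetric] flip: ennreal_mult)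
    qed simp
    finally show "(\<integral>\<^sup>+y. j y s \<partial>lborel) =
      ennreal (real k * \<omega> * s) * indicator {0..d} s" .
  qed
  also have "\<dots> = ennreal (real k * \<omega> * d\<^sup>2 / 2 - real k * \<omega> * 0\<^sup>2 / 2)"
    by (rule nn_integral_FTC_Icc) (use \<omega> d in \<open>auto intro!: derivative_eq_intros\<close>)
  also have "ennreal (1 / d ^ k) * emeasure lborel (cball x d) = ennreal (\<omega> * d\<^sup>2)"
  proof -
    have "1 / d ^ k * (\<omega> * d ^ N) = \<omega> * d\<^sup>2" using d k by (simp add: power_add power2_eq_square)
    then show ?thesis
      using d \<omega> by (simp add: emeasure_cball N_def[symmetric] \<omega>_def[symmetric] flip: ennreal_mult)
  qed
  \<comment> \<open>As N = k + 2, the sum is \<open>\<omega> * d\<^sup>2 * N / 2\<close>; multiplied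
    by \<open>c = 1 / (N * k * \<omega>)\<close> it becomes \<open>d\<^sup>2 / (2 * k)\<close>, the
    form of \<open>l0\<close>.\<close>
  also have "ennreal (\<omega> * d\<^sup>2) + ennreal (real k * \<omega> * d\<^sup>2 / 2 - real k * \<omega> * 0\<^sup>2 / 2)
     = ennreal (\<omega> * d\<^sup>2 * real N / 2)"
    using \<omega> k by (simp add: algebra_simps flip: ennreal_plus)
  finally have *: "(\<integral>\<^sup>+y. ennreal (1 / dist x y ^ k) * indicator (cball x d) y \<partial>lborel)
    \<le> ennreal (\<omega> * d\<^sup>2 * real N / 2)" .
  have "(\<integral>\<^sup>+y. ennreal (fundamental_solution (x - y)) * indicator (cball x d) y \<partial>lborel)
    = ennreal c * (\<integral>\<^sup>+y. ennreal (1 / dist x y ^ k) * indicator (cball x d) y \<partial>lborel)"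
    unfolding Phi using c
    by (subst nn_integral_cmult[symmetric])
      (auto simp del: times_divide_eq_right simp: ennreal_mult mult.assoc borel_closed
        intro!: borel_measurable_times_ennreal borel_measurable_indicator)
  also have "\<dots> \<le> ennreal c * ennreal (\<omega> * d\<^sup>2 * real N / 2)"
    by (intro mult_left_mono *) simp
  also have "\<dots> = ennreal (d\<^sup>2 / (2 * (real DIM('a) - 2)))"
    proof -
    have "c * (\<omega> * d\<^sup>2 * real N / 2) = d\<^sup>2 / (2 * (real DIM('a) - 2))"
      using \<omega> k unfolding c_def N_def[symmetric] k(2)
      by (simp add: divide_simps)
    then show ?thesis using c \<omega> by (subst ennreal_mult[symmetric]) (auto simp only:, auto)
  qed
  finally show ?thesis .
qed

text \<open>Seen from any of its points, U lies in the closed ball whose radius is the diameter of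
  U. A small ball inside U shows that this radius is positive.\<close>

lemma nn_integral_fundamental_solution_le_l0:
  fixes U :: "'a::euclidean_space set"
  assumes n: "DIM('a) \<ge> 3" and U: "open U" "bounded U" and x: "x \<in> U"
  shows "(\<integral>\<^sup>+y. ennreal (fundamental_solution (x - y)) \<partial>lebesgue_on U) \<le> ennreal (l0 U)"
proof -
  obtain e where e: "e > 0" "ball x e \<subseteq> U" using U x by (meson openE)
  have "0 < diameter (ball x e)" using e by simp
  also have "\<dots> \<le> diameter U" by (rule diameter_subset[OF e(2) U(2)])
  finally have d: "diameter U > 0" .
  have "(\<integral>\<^sup>+y. ennreal (fundamental_solution (x - y)) \<partial>lebesgue_on U)
    = (\<integral>\<^sup>+y. ennreal (fundamental_solution (x - y)) * indicator U y \<partial>lebesgue)"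
    using U by (intro nn_integral_restrict_space) (auto simp: lborelD borel_open)
  also have "\<dots> \<le> (\<integral>\<^sup>+y. ennreal (fundamental_solution (x - y)) * indicator (cball x (diameter U)) y \<partial>lebesgue)"
    using diameter_bounded_bound[OF U(2) x]
    by (intro nn_integral_mono mult_left_mono) (auto simp: indicator_def)
  also have "\<dots> \<le> ennreal (l0 U)"
    unfolding l0_def nn_integral_completion by (rule nn_integral_fundamental_solution_cball[OF n d])
  finally show ?thesis .
qed

lemma AE_lebesgue_on_neq:
  assumes "open U"
  shows "AE y in lebesgue_on U. y \<in> U \<and> y \<noteq> (x :: 'a::euclidean_space)"
proof -
  have "AE y in lebesgue. y \<noteq> x"
    using AE_lborel_singleton by (rule AE_completion)
  then show ?thesis
    using assms by (subst AE_restrict_space_iff) (auto simp: lborelD borel_open elim: eventually_mono)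
qed

lemma l0_nonneg: "DIM('a::euclidean_space) \<ge> 3 \<Longrightarrow> 0 \<le> l0 (U :: 'a set)"
  by (simp add: l0_def)

text \<open>The integrand is dominated by \<open>?F y * C\<close> off the pole, which is a null set.
  Integrability is recorded separately because splitting \<open>green_op\<close> over sums requires
  it: a Bochner integral that does not exist is 0.\<close>

lemma
  fixes U :: "'a::euclidean_space set"
  assumes n: "DIM('a) \<ge> 3" and U: "open U" "bounded U" and x: "x \<in> U"
    and \<phi>: "\<phi> \<in> borel_measurable (lebesgue_on U)" and C: "AE y in lebesgue_on U. \<bar>\<phi> y\<bar> \<le> C"
  shows integrable_green: "integrable (lebesgue_on U) (\<lambda>y. green U x y * \<phi> y)"
    and green_op_bound: "0 \<le> C \<Longrightarrow> \<bar>green_op U \<phi> x\<bar> \<le> l0 U * C"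
proof -
  let ?F = "\<lambda>y. fundamental_solution (x - y) :: real"
  note [measurable] = borel_measurable_green[OF n U x] \<phi>
  have Fm[measurable]: "?F \<in> borel_measurable (lebesgue_on U)"
    by (rule borel_measurable_lebesgue_onI) measurable
  note F0 = fundamental_solution_nonneg[OF n]
  note nn = nn_integral_fundamental_solution_le_l0[OF n U x]
  have Fi: "integrable (lebesgue_on U) ?F"
    by (rule integrableI_nonneg) (use nn F0 in \<open>auto simp: less_top[symmetric] top_unique\<close>)
  have Fl: "(\<integral>y. ?F y \<partial>lebesgue_on U) \<le> l0 U"
    using nn F0 Fi l0_nonneg[OF n, of U] by (subst (asm) nn_integral_eq_integral) auto
  have le: "AE y in lebesgue_on U. \<bar>green U x y * \<phi> y\<bar> \<le> ?F y * C"
    using AE_lebesgue_on_neq[OF U(1), of x] C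
  proof eventually_elim
    case (elim y)
    then show ?case using green_bounds[OF n U x, of y] F0[of "x - y"]
      by (auto simp: abs_mult intro!: mult_mono)
  qed
  show i: "integrable (lebesgue_on U) (\<lambda>y. green U x y * \<phi> y)"
    by (rule Bochner_Integration.integrable_bound[of _ "\<lambda>y. ?F y * C"])
      (use Fi le in \<open>auto elim!: eventually_mono\<close>)
  assume C0: "0 \<le> C"
  have "\<bar>green_op U \<phi> x\<bar> \<le> (\<integral>y. \<bar>green U x y * \<phi> y\<bar> \<partial>lebesgue_on U)"
    unfolding green_op_def by (rule integral_abs_bound)
  also have "\<dots> \<le> (\<integral>y. ?F y * C \<partial>lebesgue_on U)"
    by (rule integral_mono_AE) (use i Fi le in auto)
  also have "\<dots> \<le> l0 U * C" using Fl C0 by (simp add: mult_right_mono)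
  finally show "\<bar>green_op U \<phi> x\<bar> \<le> l0 U * C" .
qed

section \<open>Finite signed measures and their potentials\<close>

text \<open>The properties of \<open>radon_measures\<close> that govern integration. The class is
  closed under negation and difference, so it covers the negative Jordan part and \<mu> - \<nu>
  without further arguments.\<close>

definition finite_signed_measure :: "'a::euclidean_space set \<Rightarrow> ('a set \<Rightarrow> real) \<Rightarrow> bool" where
  "finite_signed_measure U \<mu> \<longleftrightarrow>
     (\<forall>A::nat \<Rightarrow> 'a set. range A \<subseteq> borel_sets_in U \<and> disjoint_family A \<longrightarrow>
        (\<lambda>i. \<mu> (A i)) sums \<mu> (\<Union>i. A i)) \<and>
     variation U \<mu> U < \<infinity>"

lemma radon_imp_finite_signed_measure: "\<mu> \<in> radon_measures U \<Longrightarrow> finite_signed_measure U \<mu>"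
  by (simp add: radon_measures_def finite_signed_measure_def)

lemma finite_signed_measure_sums:
  "finite_signed_measure U \<mu> \<Longrightarrow> (\<And>i::nat. A i \<in> borel_sets_in U) \<Longrightarrow> disjoint_family A \<Longrightarrow>
    (\<lambda>i. \<mu> (A i)) sums \<mu> (\<Union>i. A i)"
  unfolding finite_signed_measure_def by blast

lemma finite_signed_measure_empty:
  assumes "finite_signed_measure U \<mu>"
  shows "\<mu> {} = 0"
proof -
  have "(\<lambda>i::nat. \<mu> {}) sums \<mu> (\<Union>i::nat. {})"
    by (rule finite_signed_measure_sums[OF assms]) (auto simp: disjoint_family_on_def)
  then show ?thesis using summable_const_iff[of "\<mu> {}"] by (auto dest: sums_summable)
qed

section \<open>The total variation as a measure\<close>

lemma variation_minus: "variation U (\<lambda>A. - \<mu> A) = variation U \<mu>"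
  by (simp add: variation_def fun_eq_iff)

lemma variation_add_le:
  "variation U (\<lambda>A. \<mu> A + \<nu> A) S \<le> variation U \<mu> S + variation U \<nu> S"
  unfolding variation_def
proof (rule SUP_least)
  fix P assume P: "P \<in> {P. finite P \<and> partition_on S P \<and> P \<subseteq> borel_sets_in U}"
  have "(\<Sum>B\<in>P. ennreal \<bar>\<mu> B + \<nu> B\<bar>) \<le> (\<Sum>B\<in>P. ennreal \<bar>\<mu> B\<bar>) + (\<Sum>B\<in>P. ennreal \<bar>\<nu> B\<bar>)"
    unfolding sum.distrib[symmetric]
    by (intro sum_mono) (simp add: abs_triangle_ineq ennreal_leI flip: ennreal_plus)
  also have "\<dots> \<le> (SUP P\<in>{P. finite P \<and> partition_on S P \<and> P \<subseteq> borel_sets_in U}. \<Sum>B\<in>P. ennreal \<bar>\<mu> B\<bar>)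
     + (SUP P\<in>{P. finite P \<and> partition_on S P \<and> P \<subseteq> borel_sets_in U}. \<Sum>B\<in>P. ennreal \<bar>\<nu> B\<bar>)"
    by (intro add_mono SUP_upper P)
  finally show "(\<Sum>B\<in>P. ennreal \<bar>\<mu> B + \<nu> B\<bar>) \<le> \<dots>" .
qed

lemma finite_signed_measure_minus:
  "finite_signed_measure U \<mu> \<Longrightarrow> finite_signed_measure U (\<lambda>A. - \<mu> A)"
  unfolding finite_signed_measure_def variation_minus by (auto intro: sums_minus)

lemma finite_signed_measure_diff:
  assumes "finite_signed_measure U \<mu>" "finite_signed_measure U \<nu>"
  shows "finite_signed_measure U (\<lambda>A. \<mu> A - \<nu> A)"
proof -
  have "variation U (\<lambda>A. \<mu> A - \<nu> A) U \<le> variation U \<mu> U + variation U \<nu> U"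
    using variation_add_le[of U \<mu> "\<lambda>A. - \<nu> A" U] by (simp add: variation_minus)
  also have "\<dots> < \<infinity>" using assms by (simp add: finite_signed_measure_def)
  finally show ?thesis
    using assms unfolding finite_signed_measure_def by (auto intro: sums_diff)
qed

lemma partition_sum_le_variation:
  "finite P \<Longrightarrow> partition_on A P \<Longrightarrow> P \<subseteq> borel_sets_in U \<Longrightarrow>
    (\<Sum>B\<in>P. ennreal \<bar>\<mu> B\<bar>) \<le> variation U \<mu> A"
  unfolding variation_def by (rule SUP_upper) auto

lemma abs_le_variation:
  assumes "finite_signed_measure U \<mu>" "A \<in> borel_sets_in U"
  shows "ennreal \<bar>\<mu> A\<bar> \<le> variation U \<mu> A"
proof (cases "A = {}")
  case True
  then show ?thesis using finite_signed_measure_empty[OF assms(1)] by simp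
next
  case False
  then show ?thesis
    using partition_sum_le_variation[of "{A}" A U \<mu>] assms(2)
    by (simp add: partition_on_def)
qed

lemma partitions_nonempty:
  assumes "A \<in> borel_sets_in U"
  shows "{P. finite P \<and> partition_on A P \<and> P \<subseteq> borel_sets_in U} \<noteq> {}"
proof -
  \<comment> \<open>Blocks of a partition are nonempty, so the trivial partition of the empty set is
    the empty family.\<close>
  have "{A} - {{}} \<in> {P. finite P \<and> partition_on A P \<and> P \<subseteq> borel_sets_in U}"
    using assms by (auto simp: partition_on_def disjoint_def)
  then show ?thesis by blast
qed

text \<open>A partition of A and one of B together partition the union. They share no block, since
  blocks are nonempty and A, B disjoint, so the two sums simply add up.\<close>

lemma variation_superadditive:
  assumes A: "A \<in> borel_sets_in U" and B: "B \<in> borel_sets_in U" and AB: "A \<inter> B = {}"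
  shows "variation U \<mu> A + variation U \<mu> B \<le> variation U \<mu> (A \<union> B)"
proof -
  let ?Q = "\<lambda>A. {P. finite P \<and> partition_on A P \<and> P \<subseteq> borel_sets_in U}"
  let ?s = "\<lambda>P. \<Sum>B\<in>P. ennreal \<bar>\<mu> B\<bar>"
  have *: "?s P + ?s Q \<le> variation U \<mu> (A \<union> B)" if "P \<in> ?Q A" "Q \<in> ?Q B" for P Q
  proof -
    have "P \<inter> Q = {}"
      using that AB unfolding partition_on_def by (auto) (metis Int_absorb UnionI disjoint_iff equals0I)
    then have "?s P + ?s Q = ?s (P \<union> Q)" using that by (simp add: sum.union_disjoint)
    also have "\<dots> \<le> variation U \<mu> (A \<union> B)"
    proof (rule partition_sum_le_variation)
      show "partition_on (A \<union> B) (P \<union> Q)"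
        using that AB unfolding partition_on_def
        by (auto intro!: disjoint_union)
    qed (use that in auto)
    finally show ?thesis .
  qed
  have "variation U \<mu> A + variation U \<mu> B = (SUP P\<in>?Q A. ?s P + variation U \<mu> B)"
    unfolding variation_def[of U \<mu> A]
    by (rule ennreal_SUP_add_left[symmetric]) (rule partitions_nonempty[OF A])
  also have "\<dots> \<le> variation U \<mu> (A \<union> B)"
  proof (rule SUP_least)
    fix P assume P: "P \<in> ?Q A"
    have "?s P + variation U \<mu> B = (SUP Q\<in>?Q B. ?s P + ?s Q)"
      unfolding variation_def
      by (rule ennreal_SUP_add_right) (rule partitions_nonempty[OF B])
    also have "\<dots> \<le> variation U \<mu> (A \<union> B)" by (rule SUP_least) (rule *[OF P])
    finally show "?s P + variation U \<mu> B \<le> variation U \<mu> (A \<union> B)" .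
  qed
  finally show ?thesis .
qed

lemma variation_mono:
  assumes "A \<in> borel_sets_in U" "B \<in> borel_sets_in U" "A \<subseteq> B"
  shows "variation U \<mu> A \<le> variation U \<mu> B"
proof -
  have "variation U \<mu> A \<le> variation U \<mu> A + variation U \<mu> (B - A)" by simp
  also have "\<dots> \<le> variation U \<mu> (A \<union> (B - A))"
    by (rule variation_superadditive) (use assms in auto)
  also have "A \<union> (B - A) = B" using assms by auto
  finally show ?thesis .
qed

lemma whole_in_borel_sets_in: "U \<in> borel_sets_in U"
  by (metis sets.top space_restrict_space2 space_restrict_space space_borel inf_top_right UNIV_I)

lemma ennreal_abs_le_suminf:
  assumes "f sums (x::real)"
  shows "ennreal \<bar>x\<bar> \<le> (\<Sum>i. ennreal \<bar>f i\<bar>)"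
proof (cases "(\<Sum>i. ennreal \<bar>f i\<bar>) = top")
  case False
  then have s: "summable (\<lambda>i. \<bar>f i\<bar>)" by (intro summable_suminf_not_top) auto
  have "\<bar>x\<bar> \<le> (\<Sum>i. \<bar>f i\<bar>)" using summable_rabs[OF s] assms by (simp add: sums_iff)
  then have "ennreal \<bar>x\<bar> \<le> ennreal (\<Sum>i. \<bar>f i\<bar>)" by (rule ennreal_leI)
  also have "\<dots> = (\<Sum>i. ennreal \<bar>f i\<bar>)" using s by (intro suminf_ennreal2[symmetric]) auto
  finally show ?thesis .
qed simp

text \<open>One inequality is superadditivity for finite unions followed by a limit. For the other,
  a partition of the union is cut along the sets \<open>A i\<close>: countable additivity of \<mu>
  bounds each block by its pieces, and the pieces inside one \<open>A i\<close> form a partition of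
  it.\<close>

lemma variation_countably_additive:
  fixes A :: "nat \<Rightarrow> 'a::euclidean_space set"
  assumes \<mu>: "finite_signed_measure U \<mu>" and A: "\<And>i. A i \<in> borel_sets_in U" and d: "disjoint_family A"
  shows "(\<Sum>i. variation U \<mu> (A i)) = variation U \<mu> (\<Union>i. A i)"
proof (rule antisym)
  have UA: "(\<Union>i. A i) \<in> borel_sets_in U" by (rule sets.countable_UN) (auto intro: A)
  have fin: "(\<Sum>i<n. variation U \<mu> (A i)) \<le> variation U \<mu> (\<Union>i<n. A i)" for n
  proof (induction n)
    case (Suc n)
    have "(\<Sum>i<Suc n. variation U \<mu> (A i)) \<le> variation U \<mu> (\<Union>i<n. A i) + variation U \<mu> (A n)"
      using Suc by (simp add: add_right_mono)
    also have "\<dots> \<le> variation U \<mu> ((\<Union>i<n. A i) \<union> A n)"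
    proof (rule variation_superadditive)
      show "(\<Union>i<n. A i) \<in> borel_sets_in U" by (rule sets.finite_UN) (auto intro: A)
      show "(\<Union>i<n. A i) \<inter> A n = {}"       proof -
        have "A i \<inter> A n = {}" if "i < n" for i
          using d that by (simp add: disjoint_family_on_def)
        then show ?thesis by (auto simp: set_eq_iff)
      qed
    qed (rule A)
    also have "(\<Union>i<n. A i) \<union> A n = (\<Union>i<Suc n. A i)" by (auto simp: less_Suc_eq)
    finally show ?case .
  qed simp
  show "(\<Sum>i. variation U \<mu> (A i)) \<le> variation U \<mu> (\<Union>i. A i)"
    unfolding suminf_eq_SUP
  proof (rule SUP_least)
    fix n
    have "variation U \<mu> (\<Union>i<n. A i) \<le> variation U \<mu> (\<Union>i. A i)"
    proof (rule variation_mono[OF _ UA])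
      show "(\<Union>i<n. A i) \<in> borel_sets_in U" by (rule sets.finite_UN) (auto intro: A)
    qed auto
    with fin[of n] show "(\<Sum>i<n. variation U \<mu> (A i)) \<le> variation U \<mu> (\<Union>i. A i)" by (rule order.trans)
  qed
  show "variation U \<mu> (\<Union>i. A i) \<le> (\<Sum>i. variation U \<mu> (A i))"
    unfolding variation_def[of U \<mu> "\<Union>i. A i"]
  proof (rule SUP_least, clarify)
    fix P assume P: "finite P" "partition_on (\<Union>i. A i) P" "P \<subseteq> borel_sets_in U"
    have B: "ennreal \<bar>\<mu> B\<bar> \<le> (\<Sum>i. ennreal \<bar>\<mu> (B \<inter> A i)\<bar>)" if "B \<in> P" for B
    proof -
      have "(\<lambda>i. \<mu> (B \<inter> A i)) sums \<mu> (\<Union>i. B \<inter> A i)"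
      proof (rule finite_signed_measure_sums[OF \<mu>])
        show "B \<inter> A i \<in> borel_sets_in U" for i using that P A by blast
        show "disjoint_family (\<lambda>i. B \<inter> A i)" using d by (auto simp: disjoint_family_on_def)
      qed
      moreover have "(\<Union>i. B \<inter> A i) = B" using that P by (auto simp: partition_on_def)
      ultimately show ?thesis using ennreal_abs_le_suminf by metis
    qed
    have part: "(\<Sum>B\<in>P. ennreal \<bar>\<mu> (B \<inter> A i)\<bar>) \<le> variation U \<mu> (A i)" for i
    proof -
      \<comment> \<open>Discarding empty traces makes the pieces admissible blocks and the map from
        blocks to traces injective.\<close>
      let ?P = "{B \<in> P. B \<inter> A i \<noteq> {}}"
      have dj: "B = C" if "B \<in> P" "C \<in> P" "x \<in> B" "x \<in> C" for B C x
        using P(2) that unfolding partition_on_def disjoint_def by blast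
      have "(\<Sum>B\<in>P. ennreal \<bar>\<mu> (B \<inter> A i)\<bar>) = (\<Sum>B\<in>?P. ennreal \<bar>\<mu> (B \<inter> A i)\<bar>)"
        by (rule sum.mono_neutral_right) (use P finite_signed_measure_empty[OF \<mu>] in auto)
      also have "\<dots> = (\<Sum>C\<in>(\<lambda>B. B \<inter> A i) ` ?P. ennreal \<bar>\<mu> C\<bar>)"
      proof (subst sum.reindex)
        show "inj_on (\<lambda>B. B \<inter> A i) ?P" by (auto simp: inj_on_def dest: dj)
      qed simp
      also have "\<dots> \<le> variation U \<mu> (A i)"
      proof (rule partition_sum_le_variation)
        have "A i \<subseteq> \<Union>P" using P(2) by (auto simp: partition_on_def)
        then have "\<Union>((\<lambda>B. B \<inter> A i) ` ?P) = A i" by blast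
        then show "partition_on (A i) ((\<lambda>B. B \<inter> A i) ` ?P)"
          unfolding partition_on_def disjoint_def by (auto dest: dj)
        show "(\<lambda>B. B \<inter> A i) ` ?P \<subseteq> borel_sets_in U" using P A by blast
      qed (use P in auto)
      finally show ?thesis .
    qed
    have "(\<Sum>B\<in>P. ennreal \<bar>\<mu> B\<bar>) \<le> (\<Sum>B\<in>P. \<Sum>i. ennreal \<bar>\<mu> (B \<inter> A i)\<bar>)"
      by (rule sum_mono) (rule B)
    also have "\<dots> = (\<Sum>i. \<Sum>B\<in>P. ennreal \<bar>\<mu> (B \<inter> A i)\<bar>)"
      by (rule suminf_sum[symmetric]) auto
    also have "\<dots> \<le> (\<Sum>i. variation U \<mu> (A i))"
      by (rule suminf_le[OF part]) auto
    finally show "(\<Sum>B\<in>P. ennreal \<bar>\<mu> B\<bar>) \<le> (\<Sum>i. variation U \<mu> (A i))" .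
  qed
qed

lemma variation_finite:
  assumes "finite_signed_measure U \<mu>" "A \<in> borel_sets_in U"
  shows "variation U \<mu> A < top"
proof -
  have "variation U \<mu> A \<le> variation U \<mu> U"
  proof (rule variation_mono[OF assms(2) whole_in_borel_sets_in])
    show "A \<subseteq> U" using sets.sets_into_space[OF assms(2)] by (simp add: space_restrict_space)
  qed
  then show ?thesis using assms(1) by (simp add: finite_signed_measure_def le_less_trans)
qed

section \<open>The Jordan parts and integration against a signed measure\<close>

lemma sets_positive_part[measurable_cong]: "sets (positive_part U \<mu>) = borel_sets_in U"
  unfolding positive_part_def
  by (subst sets.sets_measure_of_eq[of "restrict_space borel U", unfolded space_restrict_space, simplified]) simp

lemma space_positive_part: "space (positive_part U \<mu>) = U"
  using sets_eq_imp_space_eq[OF sets_positive_part] by (simp add: space_restrict_space)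

text \<open>Facts on positive parts thereby serve for negative parts too, with - \<mu> in place of
  \<mu>.\<close>

lemma negative_part_eq: "negative_part U \<mu> = positive_part U (\<lambda>A. - \<mu> A)"
  by (simp add: negative_part_def positive_part_def variation_minus)

text \<open>\<open>measure_of\<close> returns the prescribed values only if these are nonnegative
  and countably additive: the first holds since the variation dominates \<bar>\<mu> A\<bar>, the
  second since the variation is itself countably additive.\<close>

lemma emeasure_positive_part:
  assumes \<mu>: "finite_signed_measure U \<mu>" and A: "A \<in> borel_sets_in U"
  shows "emeasure (positive_part U \<mu>) A = ennreal ((enn2real (variation U \<mu> A) + \<mu> A) / 2)"
proof (rule emeasure_measure_of[OF positive_part_def])
  let ?v = "\<lambda>A. enn2real (variation U \<mu> A)"
  let ?p = "\<lambda>A. ennreal ((?v A + \<mu> A) / 2)"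
  note S = sets_positive_part
  show "borel_sets_in U \<subseteq> Pow U"
    using sets.space_closed[of "restrict_space borel U"] by (simp add: space_restrict_space)
  show "positive (sets (positive_part U \<mu>)) ?p"
    unfolding positive_def variation_def
    by (auto simp: partition_on_empty finite_signed_measure_empty[OF \<mu>] ennreal_eq_0_iff)
  have pos: "0 \<le> (?v A + \<mu> A) / 2" if "A \<in> borel_sets_in U" for A
  proof -
    have "\<bar>\<mu> A\<bar> \<le> ?v A"
      using enn2real_mono[OF abs_le_variation[OF \<mu> that] variation_finite[OF \<mu> that]] by simp
    then show ?thesis by simp
  qed
  show "countably_additive (sets (positive_part U \<mu>)) ?p"
    unfolding S
  proof (rule countably_additiveI)
    fix A :: "nat \<Rightarrow> 'a set"
    assume A: "range A \<subseteq> borel_sets_in U" "disjoint_family A" "(\<Union>i. A i) \<in> borel_sets_in U"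
    then have Ai: "A i \<in> borel_sets_in U" for i by blast
    have vf: "ennreal (?v B) = variation U \<mu> B" if "B \<in> borel_sets_in U" for B
      using variation_finite[OF \<mu> that] by simp
    have sv: "(\<Sum>i. ennreal (?v (A i))) = ennreal (?v (\<Union>i. A i))"
      using variation_countably_additive[OF \<mu> Ai A(2)] by (simp add: vf[OF Ai] vf[OF A(3)])
    \<comment> \<open>The variation series is moved from \<open>ennreal\<close> to the reals, where
      the signed series of \<mu> can be added.\<close>
    then have sm: "summable (\<lambda>i. ?v (A i))" by (intro summable_suminf_not_top) auto
    with sv have "(\<Sum>i. ?v (A i)) = ?v (\<Union>i. A i)"
      by (subst (asm) suminf_ennreal2) (auto simp: suminf_nonneg)
    with sm have "(\<lambda>i. ?v (A i)) sums ?v (\<Union>i. A i)" by (simp add: sums_iff)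
    then have "(\<lambda>i. (?v (A i) + \<mu> (A i)) / 2) sums ((?v (\<Union>i. A i) + \<mu> (\<Union>i. A i)) / 2)"
      by (intro sums_divide sums_add finite_signed_measure_sums[OF \<mu> Ai A(2)])
    then show "(\<Sum>i. ?p (A i)) = ?p (\<Union>i. A i)"
      by (rule suminf_ennreal_eq[rotated]) (rule pos[OF Ai])
  qed
  show "A \<in> sets (positive_part U \<mu>)" using A by (simp add: S)
qed

lemma finite_measure_positive_part:
  "finite_signed_measure U \<mu> \<Longrightarrow> finite_measure (positive_part U \<mu>)"
  by (rule finite_measureI)
    (simp add: space_positive_part emeasure_positive_part whole_in_borel_sets_in)

lemma measure_positive_part:
  assumes \<mu>: "finite_signed_measure U \<mu>" and A: "A \<in> borel_sets_in U"
  shows "measure (positive_part U \<mu>) A = (enn2real (variation U \<mu> A) + \<mu> A) / 2"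
proof -
  have "\<bar>\<mu> A\<bar> \<le> enn2real (variation U \<mu> A)"
    using enn2real_mono[OF abs_le_variation[OF assms] variation_finite[OF assms]] by simp
  then show ?thesis by (simp add: measure_def emeasure_positive_part[OF assms])
qed

text \<open>Three measures per side are what \<open>radon_integral_diff\<close> produces. Both sides
  are additive, homogeneous and continuous along increasing sequences in h, so equality on sets
  propagates by induction on h, with no subtraction in \<open>ennreal\<close>.\<close>

lemma nn_integral_eq_of_emeasure_sum_eq:
  assumes s: "sets M2 = sets M1" "sets M3 = sets M1" "sets N1 = sets M1" "sets N2 = sets M1" "sets N3 = sets M1"
    and e: "\<And>A. A \<in> sets M1 \<Longrightarrow>
      emeasure M1 A + emeasure M2 A + emeasure M3 A = emeasure N1 A + emeasure N2 A + emeasure N3 A"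
    and h: "h \<in> borel_measurable M1"
  shows "(\<integral>\<^sup>+x. h x \<partial>M1) + (\<integral>\<^sup>+x. h x \<partial>M2) + (\<integral>\<^sup>+x. h x \<partial>M3) =
    (\<integral>\<^sup>+x. h x \<partial>N1) + (\<integral>\<^sup>+x. h x \<partial>N2) + (\<integral>\<^sup>+x. h x \<partial>N3)"
proof -
  have m: "borel_measurable M2 = borel_measurable M1" "borel_measurable M3 = borel_measurable M1"
    "borel_measurable N1 = borel_measurable M1" "borel_measurable N2 = borel_measurable M1"
    "borel_measurable N3 = borel_measurable M1"
    using s by (auto intro!: measurable_cong_sets)
  note sp = s[THEN sets_eq_imp_space_eq]
  from h show ?thesis
  proof (induction rule: borel_measurable_induct)
    case (cong f g)
    then have "(\<integral>\<^sup>+x. f x \<partial>M) = (\<integral>\<^sup>+x. g x \<partial>M)" if "space M = space M1" for M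
      using that by (intro nn_integral_cong) auto
    then show ?case using cong sp by metis
  next
    case (set A)
    then show ?case using e[OF set] s by simp
  next
    case (mult u c)
    then show ?case by (simp add: nn_integral_cmult m flip: distrib_left)
  next
    case (add u v)
    have "(\<integral>\<^sup>+x. v x + u x \<partial>M) = (\<integral>\<^sup>+x. v x \<partial>M) + (\<integral>\<^sup>+x. u x \<partial>M)"
      if "borel_measurable M = (borel_measurable M1 :: ('a \<Rightarrow> ennreal) set)" for M
      using add that by (intro nn_integral_add) auto
    note this[OF refl] this[OF m(1)] this[OF m(2)] this[OF m(3)] this[OF m(4)] this[OF m(5)]
    then show ?case using arg_cong2[OF add.IH, of "(+)"] by (simp add: ac_simps)
  next
    case (seq F)
    have c: "(\<integral>\<^sup>+x. (SUP i. F i) x \<partial>M) = (SUP i. \<integral>\<^sup>+x. F i x \<partial>M)"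
      if "borel_measurable M = (borel_measurable M1 :: ('a \<Rightarrow> ennreal) set)" for M
      using seq that nn_integral_monotone_convergence_SUP[of F M] by (simp add: image_comp)
    have i: "incseq (\<lambda>i. \<integral>\<^sup>+x. F i x \<partial>M)" for M
      using seq by (auto simp: incseq_def le_fun_def intro!: nn_integral_mono)
    have i2: "incseq (\<lambda>i. (\<integral>\<^sup>+x. F i x \<partial>M) + (\<integral>\<^sup>+x. F i x \<partial>N))" for M N
      using i[of M] i[of N] by (auto simp: incseq_def intro!: add_mono)
    show ?case
      unfolding c[OF refl] c[OF m(1)] c[OF m(2)] c[OF m(3)] c[OF m(4)] c[OF m(5)]
      using seq.IH by (simp add: ennreal_SUP_add[symmetric] i i2)
  qed
qed

text \<open>Shifting h by its bound C makes it nonnegative, so that identities of nonnegative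
  integrals apply to functions of either sign; the shift costs C times the total mass.\<close>

lemma integral_bounded_eq_nn_integral:
  fixes h :: "'a \<Rightarrow> real"
  assumes M: "finite_measure M" and h: "h \<in> borel_measurable M" and C: "\<And>y. y \<in> space M \<Longrightarrow> \<bar>h y\<bar> \<le> C"
  shows "integrable M h"
    and "ennreal ((\<integral>y. h y \<partial>M) + C * measure M (space M)) = (\<integral>\<^sup>+y. ennreal (h y + C) \<partial>M)"
    and "0 \<le> (\<integral>y. h y \<partial>M) + C * measure M (space M)"
proof -
  interpret finite_measure M by fact
  show i: "integrable M h"
    by (rule integrable_const_bound[where B = C]) (use h C in \<open>auto intro!: AE_I2\<close>)
  have eq: "(\<integral>y. h y + C \<partial>M) = (\<integral>y. h y \<partial>M) + C * measure M (space M)"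
    using i by simp
  have nn: "AE y in M. 0 \<le> h y + C" using C by (intro AE_I2) (fastforce simp: abs_le_iff)
  show "ennreal ((\<integral>y. h y \<partial>M) + C * measure M (space M)) = (\<integral>\<^sup>+y. ennreal (h y + C) \<partial>M)"
    unfolding eq[symmetric] by (rule nn_integral_eq_integral[symmetric]) (use i nn in auto)
  show "0 \<le> (\<integral>y. h y \<partial>M) + C * measure M (space M)"
    unfolding eq[symmetric] by (rule integral_nonneg_AE[OF nn])
qed

text \<open>The masses of the two Jordan parts add up to the total variation.\<close>

lemma radon_integral_bound:
  assumes \<mu>: "finite_signed_measure U \<mu>" and h: "h \<in> borel_measurable (restrict_space borel U)"
    and C: "\<And>y. y \<in> U \<Longrightarrow> \<bar>h y\<bar> \<le> C"
  shows "\<bar>radon_integral U \<mu> h\<bar> \<le> C * tv_norm U \<mu>"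
proof -
  note neg = finite_signed_measure_minus[OF \<mu>]
  have *: "\<bar>\<integral>y. h y \<partial>positive_part U \<nu>\<bar> \<le> C * measure (positive_part U \<nu>) U"
    if "finite_signed_measure U \<nu>" for \<nu>
  proof -
    interpret finite_measure "positive_part U \<nu>" by (rule finite_measure_positive_part[OF that])
    have m: "h \<in> borel_measurable (positive_part U \<nu>)"
      using h by (simp cong: measurable_cong_sets add: sets_positive_part)
    have "\<bar>\<integral>y. h y \<partial>positive_part U \<nu>\<bar> \<le> (\<integral>y. \<bar>h y\<bar> \<partial>positive_part U \<nu>)" by (rule integral_abs_bound)
    also have "\<dots> \<le> (\<integral>y. C \<partial>positive_part U \<nu>)"
      by (rule integral_mono)
        (use C m in \<open>auto simp: space_positive_part intro!: integral_bounded_eq_nn_integral(1)[where C = C] finite_measure_axioms\<close>)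
    finally show ?thesis by (simp add: space_positive_part mult.commute)
  qed
  have "\<bar>radon_integral U \<mu> h\<bar> \<le>
      C * measure (positive_part U \<mu>) U + C * measure (positive_part U (\<lambda>A. - \<mu> A)) U"
    unfolding radon_integral_def negative_part_eq using *[OF \<mu>] *[OF neg] by linarith
  also have "\<dots> = C * tv_norm U \<mu>"
    by (simp add: measure_positive_part \<mu> neg whole_in_borel_sets_in variation_minus tv_norm_def field_simps)
  finally show ?thesis .
qed

text \<open>For \<kappa> = \<mu> - \<nu> the parts of \<kappa> need not be sums of parts of \<mu>
  and \<nu>, which may share mass. The relation \<mu> - \<nu> - \<kappa> = 0, sorted so that only
  positive measures are added, does hold for the parts.\<close>

lemma radon_integral_diff:
  assumes \<mu>: "finite_signed_measure U \<mu>" and \<nu>: "finite_signed_measure U \<nu>"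
    and h: "h \<in> borel_measurable (restrict_space borel U)"
    and C: "\<And>y. y \<in> U \<Longrightarrow> \<bar>h y\<bar> \<le> C"
  shows "radon_integral U (\<lambda>A. \<mu> A - \<nu> A) h = radon_integral U \<mu> h - radon_integral U \<nu> h"
proof -
  let ?\<kappa> = "\<lambda>A. \<mu> A - \<nu> A"
  have \<kappa>: "finite_signed_measure U ?\<kappa>" by (rule finite_signed_measure_diff[OF \<mu> \<nu>])
  have mm: "finite_signed_measure U (\<lambda>A. - \<mu> A)" "finite_signed_measure U (\<lambda>A. - \<nu> A)"
    "finite_signed_measure U (\<lambda>A. - ?\<kappa> A)"
    by (intro finite_signed_measure_minus \<mu> \<nu> \<kappa>)+
  let ?p = "positive_part U"
  have pm: "ennreal (measure (?p \<rho>) A) = emeasure (?p \<rho>) A" if "finite_signed_measure U \<rho>" for \<rho> A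
    using finite_measure.emeasure_eq_measure[OF finite_measure_positive_part[OF that]] by simp
  define J where "J \<rho> = (\<integral>y. h y \<partial>?p \<rho>) + C * measure (?p \<rho>) U" for \<rho>
  have J: "ennreal (J \<rho>) = (\<integral>\<^sup>+y. ennreal (h y + C) \<partial>?p \<rho>)" "0 \<le> J \<rho>"
    if "finite_signed_measure U \<rho>" for \<rho>
  proof -
    have m: "h \<in> borel_measurable (?p \<rho>)"
      using h by (simp cong: measurable_cong_sets add: sets_positive_part)
    show "ennreal (J \<rho>) = (\<integral>\<^sup>+y. ennreal (h y + C) \<partial>?p \<rho>)" "0 \<le> J \<rho>"
      using integral_bounded_eq_nn_integral(2,3)[OF finite_measure_positive_part[OF that] m, of C] C
      by (auto simp: space_positive_part J_def)
  qed
  \<comment> \<open>The rule \<open>minus_diff_eq\<close> is switched off because it would rewrite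
    the negative of \<kappa> to \<nu> - \<mu>, a form that the facts on \<kappa> do not
    match.\<close>
  have ms: "measure (?p \<mu>) A + measure (?p (\<lambda>A. - \<nu> A)) A + measure (?p (\<lambda>A. - ?\<kappa> A)) A =
      measure (?p (\<lambda>A. - \<mu> A)) A + measure (?p \<nu>) A + measure (?p ?\<kappa>) A" if "A \<in> borel_sets_in U" for A
    using that by (simp add: measure_positive_part \<mu> \<nu> \<kappa> mm variation_minus del: minus_diff_eq)
      (simp add: variation_minus field_simps)
  have "(\<integral>\<^sup>+y. ennreal (h y + C) \<partial>?p \<mu>) + (\<integral>\<^sup>+y. ennreal (h y + C) \<partial>?p (\<lambda>A. - \<nu> A))
      + (\<integral>\<^sup>+y. ennreal (h y + C) \<partial>?p (\<lambda>A. - ?\<kappa> A)) =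
    (\<integral>\<^sup>+y. ennreal (h y + C) \<partial>?p (\<lambda>A. - \<mu> A)) + (\<integral>\<^sup>+y. ennreal (h y + C) \<partial>?p \<nu>)
      + (\<integral>\<^sup>+y. ennreal (h y + C) \<partial>?p ?\<kappa>)"
  proof (rule nn_integral_eq_of_emeasure_sum_eq)
    fix A assume "A \<in> sets (?p \<mu>)"
    then have "A \<in> borel_sets_in U" by (simp add: sets_positive_part)
    from arg_cong[OF ms[OF this], of ennreal]
    show "emeasure (?p \<mu>) A + emeasure (?p (\<lambda>A. - \<nu> A)) A + emeasure (?p (\<lambda>A. - ?\<kappa> A)) A =
      emeasure (?p (\<lambda>A. - \<mu> A)) A + emeasure (?p \<nu>) A + emeasure (?p ?\<kappa>) A"
      by (simp add: pm \<mu> \<nu> \<kappa> mm del: minus_diff_eq)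
  qed (use h in \<open>auto simp: sets_positive_part cong: measurable_cong_sets\<close>)
  then have "ennreal (J \<mu> + J (\<lambda>A. - \<nu> A) + J (\<lambda>A. - ?\<kappa> A)) = ennreal (J (\<lambda>A. - \<mu> A) + J \<nu> + J ?\<kappa>)"
    by (simp add: J \<mu> \<nu> \<kappa> mm add_nonneg_nonneg del: minus_diff_eq)
  then have "J \<mu> + J (\<lambda>A. - \<nu> A) + J (\<lambda>A. - ?\<kappa> A) = J (\<lambda>A. - \<mu> A) + J \<nu> + J ?\<kappa>"
    by (subst (asm) ennreal_inj) (auto simp del: minus_diff_eq intro!: add_nonneg_nonneg J(2) \<mu> \<nu> \<kappa> mm)
  moreover have "C * measure (?p \<mu>) U + C * measure (?p (\<lambda>A. - \<nu> A)) U + C * measure (?p (\<lambda>A. - ?\<kappa> A)) U =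
      C * measure (?p (\<lambda>A. - \<mu> A)) U + C * measure (?p \<nu>) U + C * measure (?p ?\<kappa>) U"
    using arg_cong[OF ms[OF whole_in_borel_sets_in], of "\<lambda>x. C * x"] by (simp only: distrib_left)
  ultimately show ?thesis
    unfolding radon_integral_def negative_part_eq J_def by linarith
qed

section \<open>Potentials of finite signed measures\<close>

lemma borel_measurable_potential:
  assumes "finite_signed_measure U \<mu>"
  shows "potential U f \<mu> \<in> borel_measurable borel"
proof -
  have f[measurable]: "apply_bcontfun f \<in> borel_measurable borel"
    by (intro borel_measurable_continuous_onI continuous_on_apply_bcontfun)
  have *: "(\<lambda>x. \<integral>y. f (x - y) \<partial>positive_part U \<nu>) \<in> borel_measurable borel"
    if "finite_signed_measure U \<nu>" for \<nu>
  proof -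
    interpret finite_measure "positive_part U \<nu>" by (rule finite_measure_positive_part[OF that])
    have [measurable]: "(\<lambda>y. y) \<in> borel_measurable (positive_part U \<nu>)"
      by (simp cong: measurable_cong_sets add: sets_positive_part measurable_restrict_space1)
    show ?thesis by (rule borel_measurable_lebesgue_integral) measurable
  qed
  show ?thesis
    unfolding potential_def[abs_def] radon_integral_def negative_part_eq
    by (intro borel_measurable_diff * assms finite_signed_measure_minus)
qed

lemma bcontfun_translate_measurable:
  fixes f :: "'a::euclidean_space \<Rightarrow>\<^sub>C real"
  shows
  "(\<lambda>y. apply_bcontfun f (x - y)) \<in> borel_measurable (restrict_space borel U)"
proof -
  have "continuous_on UNIV (\<lambda>y. apply_bcontfun f (x - y))"
    by (rule continuous_on_compose2[OF continuous_on_apply_bcontfun[of UNIV]]) (auto intro!: continuous_on_op_minus)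
  then show ?thesis by (intro measurable_restrict_space1 borel_measurable_continuous_onI)
qed

lemma potential_bound:
  assumes "finite_signed_measure U \<mu>"
  shows "\<bar>potential U f \<mu> x\<bar> \<le> norm f * tv_norm U \<mu>"
  unfolding potential_def
  by (rule radon_integral_bound[OF assms bcontfun_translate_measurable])
    (metis norm_bounded real_norm_def)

lemma potential_diff:
  assumes "finite_signed_measure U \<mu>" "finite_signed_measure U \<nu>"
  shows "potential U f (\<lambda>A. \<mu> A - \<nu> A) x = potential U f \<mu> x - potential U f \<nu> x"
  unfolding potential_def
  by (rule radon_integral_diff[OF assms bcontfun_translate_measurable, where C = "norm f"])
    (metis norm_bounded real_norm_def)

section \<open>The total variation metric\<close>

lemma tv_norm_diff_commute: "tv_norm U (\<lambda>A. \<mu> A - \<nu> A) = tv_norm U (\<lambda>A. \<nu> A - \<mu> A)"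
  using variation_minus[of U "\<lambda>A. \<mu> A - \<nu> A"] by (simp add: tv_norm_def)

lemma tv_norm_triangle:
  assumes "finite_signed_measure U \<mu>" "finite_signed_measure U \<nu>"
  shows "tv_norm U (\<lambda>A. \<mu> A + \<nu> A) \<le> tv_norm U \<mu> + tv_norm U \<nu>"
proof -
  have "tv_norm U (\<lambda>A. \<mu> A + \<nu> A) \<le> enn2real (variation U \<mu> U + variation U \<nu> U)"
    unfolding tv_norm_def
    by (rule enn2real_mono[OF variation_add_le]) (use assms in \<open>simp add: finite_signed_measure_def\<close>)
  also have "\<dots> = tv_norm U \<mu> + tv_norm U \<nu>"
    unfolding tv_norm_def using assms by (intro enn2real_plus) (auto simp: finite_signed_measure_def)
  finally show ?thesis .
qed

text \<open>Makes \<open>mtopology\<close> in \<open>radon_borel\<close> a genuine metric topology.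
  Zero distance forces equality on Borel subsets of U through the variation, and on all other sets
  through the normalization in \<open>radon_measures\<close>.\<close>

lemma Metric_space_radon_measures:
  "Metric_space (radon_measures U) (\<lambda>\<mu> \<nu>. tv_norm U (\<lambda>A. \<mu> A - \<nu> A))"
proof
  show "0 \<le> tv_norm U (\<lambda>A. \<mu> A - \<nu> A)" for \<mu> \<nu> by (simp add: tv_norm_def)
  show "tv_norm U (\<lambda>A. \<mu> A - \<nu> A) = tv_norm U (\<lambda>A. \<nu> A - \<mu> A)" for \<mu> \<nu>
    by (rule tv_norm_diff_commute)
next
  fix \<mu> \<nu> assume \<mu>: "\<mu> \<in> radon_measures U" and \<nu>: "\<nu> \<in> radon_measures U"
  show "tv_norm U (\<lambda>A. \<mu> A - \<nu> A) = 0 \<longleftrightarrow> \<mu> = \<nu>"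
  proof
    assume z: "tv_norm U (\<lambda>A. \<mu> A - \<nu> A) = 0"
    let ?\<kappa> = "\<lambda>A. \<mu> A - \<nu> A"
    have \<kappa>: "finite_signed_measure U ?\<kappa>"
      by (intro finite_signed_measure_diff radon_imp_finite_signed_measure \<mu> \<nu>)
    have v0: "variation U ?\<kappa> U = 0"
      using z variation_finite[OF \<kappa> whole_in_borel_sets_in]
      by (auto simp: tv_norm_def enn2real_eq_0_iff)
    show "\<mu> = \<nu>"
    proof
      fix A
      show "\<mu> A = \<nu> A"
      proof (cases "A \<in> borel_sets_in U")
        case True
        have "ennreal \<bar>?\<kappa> A\<bar> \<le> variation U ?\<kappa> A" by (rule abs_le_variation[OF \<kappa> True])
        also have "\<dots> \<le> variation U ?\<kappa> U"
          using sets.sets_into_space[OF True]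
          by (intro variation_mono True whole_in_borel_sets_in) (simp add: space_restrict_space)
        finally show ?thesis by (simp add: v0)
      next
        case False
        then show ?thesis using \<mu> \<nu> by (auto simp: radon_measures_def)
      qed
    qed
  next
    assume "\<mu> = \<nu>"
    moreover have "variation U (\<lambda>_. 0) U = 0"
      unfolding variation_def by (auto intro!: antisym SUP_least)
    ultimately show "tv_norm U (\<lambda>A. \<mu> A - \<nu> A) = 0" by (simp add: tv_norm_def)
  qed
next
  fix \<mu> \<nu> \<rho> assume "\<mu> \<in> radon_measures U" "\<nu> \<in> radon_measures U" "\<rho> \<in> radon_measures U"
  then have "finite_signed_measure U (\<lambda>A. \<mu> A - \<nu> A)" "finite_signed_measure U (\<lambda>A. \<nu> A - \<rho> A)"
    by (auto intro!: finite_signed_measure_diff intro: radon_imp_finite_signed_measure)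
  from tv_norm_triangle[OF this]
  show "tv_norm U (\<lambda>A. \<mu> A - \<rho> A) \<le> tv_norm U (\<lambda>A. \<mu> A - \<nu> A) + tv_norm U (\<lambda>A. \<nu> A - \<rho> A)"
    by simp
qed

section \<open>Dependence of the solution on the measure\<close>

lemma emeasure_lebesgue_on_open_neq_0:
  assumes "open U" "U \<noteq> {}"
  shows "emeasure (lebesgue_on U) (space (lebesgue_on U)) \<noteq> 0"
proof -
  have "U \<notin> null_sets lebesgue"
    using open_not_negligible[OF assms] by (simp add: negligible_iff_null_sets)
  then show ?thesis
    using assms by (auto simp: emeasure_restrict_space lborelD borel_open space_restrict_space null_sets_def)
qed

text \<open>\<open>real_of_ereal\<close> sends infinite values to 0, so the norm is faithful only
  for a finite essential supremum. It is nonnegative because a nonempty open U has positive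
  measure.\<close>

lemma ereal_Linf_norm:
  assumes U: "open U" "U \<noteq> {}" and u: "u \<in> Linf U"
  shows "ereal (Linf_norm U u) = esssup (lebesgue_on U) (\<lambda>x. ereal \<bar>u x\<bar>)" and "0 \<le> Linf_norm U u"
proof -
  let ?s = "esssup (lebesgue_on U) (\<lambda>x. ereal \<bar>u x\<bar>)"
  have "0 = esssup (lebesgue_on U) (\<lambda>x. 0::ereal)"
    by (rule esssup_const[symmetric, OF emeasure_lebesgue_on_open_neq_0[OF U]])
  also have "\<dots> \<le> ?s" by (rule esssup_mono) auto
  finally have "0 \<le> ?s" .
  moreover have "?s < \<infinity>" using u by (simp add: Linf_def)
  ultimately show "ereal (Linf_norm U u) = ?s" "0 \<le> Linf_norm U u"
    unfolding Linf_norm_def by (auto simp: real_of_ereal_pos ereal_real)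
qed

lemma Linf_measurable: "u \<in> Linf U \<Longrightarrow> u \<in> borel_measurable (lebesgue_on U)"
  by (simp add: Linf_def)

lemma AE_le_Linf_norm:
  assumes "open U" "U \<noteq> {}" "u \<in> Linf U"
  shows "AE x in lebesgue_on U. \<bar>u x\<bar> \<le> Linf_norm U u"
  using esssup_AE[of "\<lambda>x. ereal \<bar>u x\<bar>" "lebesgue_on U"]
  unfolding ereal_Linf_norm(1)[OF assms, symmetric] by simp

lemma
  assumes "open U" "U \<noteq> {}" and u: "u \<in> borel_measurable (lebesgue_on U)"
    and "AE x in lebesgue_on U. \<bar>u x\<bar> \<le> c"
  shows Linf_of_AE_le: "u \<in> Linf U" and Linf_norm_le: "Linf_norm U u \<le> c"
proof -
  have le: "esssup (lebesgue_on U) (\<lambda>x. ereal \<bar>u x\<bar>) \<le> ereal c"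
    by (rule esssup_I) (use assms in auto)
  then show *: "u \<in> Linf U" using u by (auto simp: Linf_def intro: le_less_trans)
  show "Linf_norm U u \<le> c" using le unfolding ereal_Linf_norm(1)[OF assms(1,2) *, symmetric] by simp
qed

text \<open>Mean value theorem for b > 0. The case b = 0 is elementary and kept apart, as the
  derivative of \<open>powr\<close> is available for positive bases only.\<close>

lemma powr_diff_le:
  fixes a b p :: real
  assumes "0 \<le> b" "b \<le> a" "1 < p"
  shows "a powr p - b powr p \<le> p * a powr (p - 1) * (a - b)"
proof -
  consider "a = b" | "b = 0" "b < a" | "0 < b" "b < a" using assms by linarith
  then show ?thesis
  proof cases
    case 2
    have "a powr p = a powr (p - 1) * a" using 2 by (simp add: powr_mult_base mult.commute)
    also have "\<dots> \<le> p * (a powr (p - 1) * a)" using 2 assms mult_right_mono[of 1 p "a powr (p - 1) * a"] by simp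
    finally show ?thesis using 2 assms by simp
  next
    case 3
    have "((\<lambda>x. x powr p) has_real_derivative p * x powr (p - 1)) (at x)" if "b \<le> x" for x
      using that 3 by (intro has_real_derivative_powr) auto
    then obtain z where z: "b < z" "z < a" "a powr p - b powr p = (a - b) * (p * z powr (p - 1))"
      using MVT2[of b a "\<lambda>x. x powr p" "\<lambda>x. p * x powr (p - 1)"] 3 by blast
    have "z powr (p - 1) \<le> a powr (p - 1)" using z 3 assms by (intro powr_mono2) auto
    then have "(a - b) * (p * z powr (p - 1)) \<le> (a - b) * (p * a powr (p - 1))"
      using z assms by (intro mult_left_mono) auto
    then show ?thesis using z(3) by (simp add: ac_simps)
  qed simp
qed

text \<open>Source of the factor p in \<open>Kconst\<close>. For equal signs, oddness reduces the
  claim to \<open>powr_diff_le\<close>; for opposite signs each term is bounded alone, because then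
  \<bar>x\<bar> + \<bar>y\<bar> = \<bar>x - y\<bar>.\<close>

lemma signed_powr_lipschitz:
  fixes a b p R :: real
  assumes p: "1 < p" and a: "\<bar>a\<bar> \<le> R" and b: "\<bar>b\<bar> \<le> R"
  shows "\<bar>a * \<bar>a\<bar> powr (p - 1) - b * \<bar>b\<bar> powr (p - 1)\<bar> \<le> p * R powr (p - 1) * \<bar>a - b\<bar>"
proof -
  let ?n = "\<lambda>t::real. t * \<bar>t\<bar> powr (p - 1)"
  have pos: "?n t = t powr p" if "0 \<le> t" for t
    using that by (cases "t = 0") (simp_all add: powr_mult_base)
  have same: "\<bar>?n x - ?n y\<bar> \<le> p * R powr (p - 1) * \<bar>x - y\<bar>"
    if "0 \<le> y" "y \<le> x" "x \<le> R" for x y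
  proof -
    have "y powr p \<le> x powr p" using that p by (intro powr_mono2) auto
    then have "\<bar>?n x - ?n y\<bar> = x powr p - y powr p" using that by (simp only: pos)
    also have "\<dots> \<le> p * x powr (p - 1) * (x - y)" by (rule powr_diff_le) (use that p in auto)
    also have "\<dots> \<le> p * R powr (p - 1) * \<bar>x - y\<bar>"
      using that p by (intro mult_mono powr_mono2 mult_nonneg_nonneg) auto
    finally show ?thesis .
  qed
  have opp: "\<bar>?n x - ?n y\<bar> \<le> p * R powr (p - 1) * \<bar>x - y\<bar>"
    if "y \<le> 0" "0 \<le> x" "x \<le> R" "- y \<le> R" for x y
  proof -
    have *: "\<bar>?n t\<bar> \<le> p * R powr (p - 1) * \<bar>t\<bar>" if "\<bar>t\<bar> \<le> R" for t
    proof -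
      have "\<bar>?n t\<bar> = 1 * \<bar>t\<bar> powr (p - 1) * \<bar>t\<bar>" by (simp add: abs_mult)
      also have "\<dots> \<le> p * R powr (p - 1) * \<bar>t\<bar>"
        using that p by (intro mult_mono powr_mono2 mult_nonneg_nonneg) auto
      finally show ?thesis .
    qed
    have "\<bar>?n x - ?n y\<bar> \<le> \<bar>?n x\<bar> + \<bar>?n y\<bar>" by simp
    also have "\<dots> \<le> p * R powr (p - 1) * (\<bar>x\<bar> + \<bar>y\<bar>)"
      unfolding distrib_left by (intro add_mono *) (use that in auto)
    also have "\<bar>x\<bar> + \<bar>y\<bar> = \<bar>x - y\<bar>" using that by simp
    finally show ?thesis .
  qed
  have neg: "?n (- t) = - ?n t" for t by simp
  consider "0 \<le> b" "b \<le> a" | "0 \<le> a" "a \<le> b" | "b \<le> 0" "0 \<le> a" | "a \<le> 0" "0 \<le> b"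
    | "a \<le> b" "b \<le> 0" | "b \<le> a" "a \<le> 0"
    by linarith
  then show ?thesis
  proof cases
    case 1 then show ?thesis using same[of b a] a by simp
  next
    case 2 then show ?thesis using same[of a b] b by (simp add: abs_minus_commute)
  next
    case 3 then show ?thesis using opp[of b a] a b by simp
  next
    case 4 then show ?thesis using opp[of a b] a b by (simp add: abs_minus_commute)
  next
    case 5 then show ?thesis using same[of "- b" "- a"] a unfolding neg by (simp add: abs_minus_commute)
  next
    case 6 then show ?thesis using same[of "- a" "- b"] b unfolding neg by (simp add: abs_minus_commute)
  qed
qed

lemma Kconst_nonneg:
  fixes U :: "'a::euclidean_space set"
  assumes "DIM('a) \<ge> 3" "open U" "U \<noteq> {}" "b \<in> Linf U" "1 < p"
  shows "0 \<le> Kconst U b p"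
  using l0_nonneg[OF assms(1)] ereal_Linf_norm(2)[OF assms(2-4)] assms(5) by (simp add: Kconst_def)

text \<open>The potential terms are split as V\<mu> u - V\<nu> v = V\<mu> (u - v) + (V\<mu> -
  V\<nu>) v, so the factor of the unknown difference involves \<open>tau\<close> at the fixed
  measure \<mu> only. The g terms cancel.\<close>

lemma integral_solution_diff_estimate:
  fixes U :: "'a::euclidean_space set"
  assumes n: "DIM('a) \<ge> 3" and U: "open U" "bounded U" "U \<noteq> {}" and p: "1 < p"
    and b: "b \<in> Linf U"
    and \<mu>: "finite_signed_measure U \<mu>" and \<nu>: "finite_signed_measure U \<nu>"
    and u: "integral_solution U f b p g \<mu> u" "Linf_norm U u \<le> R"
    and v: "integral_solution U f b p g \<nu> v" "Linf_norm U v \<le> R"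
  shows "(\<lambda>x. u x - v x) \<in> Linf U"
    and "Linf_norm U (\<lambda>x. u x - v x) \<le>
      (tau U f \<mu> + Kconst U b p * R powr (p - 1)) * Linf_norm U (\<lambda>x. u x - v x)
      + l0 U * norm f * R * tv_norm U (\<lambda>A. \<mu> A - \<nu> A)"
proof -
  have uL: "u \<in> Linf U" and vL: "v \<in> Linf U" using u v by (auto simp: integral_solution_def)
  note [measurable] = Linf_measurable[OF uL] Linf_measurable[OF vL] Linf_measurable[OF b]
  have Vm[measurable]: "potential U f \<mu> \<in> borel_measurable (lebesgue_on U)"
    "potential U f \<nu> \<in> borel_measurable (lebesgue_on U)"
    by (intro borel_measurable_lebesgue_onI borel_measurable_potential \<mu> \<nu>)+
  have uR: "AE x in lebesgue_on U. \<bar>u x\<bar> \<le> R"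
    using AE_le_Linf_norm[OF U(1,3) uL] u(2) by (auto elim!: eventually_mono)
  have vR: "AE x in lebesgue_on U. \<bar>v x\<bar> \<le> R"
    using AE_le_Linf_norm[OF U(1,3) vL] v(2) by (auto elim!: eventually_mono)
  have R: "0 \<le> R" using ereal_Linf_norm(2)[OF U(1,3) uL] u(2) by simp
  have bB: "AE x in lebesgue_on U. \<bar>b x\<bar> \<le> Linf_norm U b" by (rule AE_le_Linf_norm[OF U(1,3) b])
  have B: "0 \<le> Linf_norm U b" by (rule ereal_Linf_norm(2)[OF U(1,3) b])
  define D where "D = Linf_norm U (\<lambda>x. u x - v x)"
  show dL: "(\<lambda>x. u x - v x) \<in> Linf U"
  proof (rule Linf_of_AE_le[OF U(1,3)])
    show "AE x in lebesgue_on U. \<bar>u x - v x\<bar> \<le> 2 * R"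
      using uR vR by eventually_elim auto
  qed measurable
  have dD: "AE x in lebesgue_on U. \<bar>u x - v x\<bar> \<le> D"
    unfolding D_def by (rule AE_le_Linf_norm[OF U(1,3) dL])
  have D: "0 \<le> D" unfolding D_def by (rule ereal_Linf_norm(2)[OF U(1,3) dL])
  let ?t = "tv_norm U (\<lambda>A. \<mu> A - \<nu> A)"
  let ?N = "\<lambda>w y. b y * w y * \<bar>w y\<bar> powr (p - 1)"
  have V\<mu>: "\<bar>potential U f \<mu> y\<bar> \<le> norm f * tv_norm U \<mu>" for y by (rule potential_bound[OF \<mu>])
  have Vd: "\<bar>potential U f \<mu> y - potential U f \<nu> y\<bar> \<le> norm f * ?t" for y
    using potential_bound[OF finite_signed_measure_diff[OF \<mu> \<nu>], of f y] potential_diff[OF \<mu> \<nu>, of f y]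
    by simp
  have tv0: "0 \<le> tv_norm U \<rho>" for \<rho> by (simp add: tv_norm_def)
  \<comment> \<open>Chosen so that u - v = H(\<psi>) almost everywhere.\<close>
  define \<psi> where "\<psi> y = potential U f \<nu> y * v y - potential U f \<mu> y * u y + (?N u y - ?N v y)" for y
  define C where "C = norm f * tv_norm U \<mu> * D + norm f * ?t * R + Linf_norm U b * (p * R powr (p - 1) * D)"
  have C0: "0 \<le> C" unfolding C_def using D R B p tv0 by (intro add_nonneg_nonneg mult_nonneg_nonneg) auto
  have \<psi>m: "\<psi> \<in> borel_measurable (lebesgue_on U)" unfolding \<psi>_def by measurable
  have \<psi>C: "AE y in lebesgue_on U. \<bar>\<psi> y\<bar> \<le> C"
    using uR vR bB dD
  proof eventually_elim
    case (elim y)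
    have "\<psi> y = - (potential U f \<mu> y * (u y - v y)) - (potential U f \<mu> y - potential U f \<nu> y) * v y
      + b y * (u y * \<bar>u y\<bar> powr (p - 1) - v y * \<bar>v y\<bar> powr (p - 1))"
      by (simp add: \<psi>_def algebra_simps)
    then have "\<bar>\<psi> y\<bar> \<le> \<bar>potential U f \<mu> y\<bar> * \<bar>u y - v y\<bar> + \<bar>potential U f \<mu> y - potential U f \<nu> y\<bar> * \<bar>v y\<bar>
      + \<bar>b y\<bar> * \<bar>u y * \<bar>u y\<bar> powr (p - 1) - v y * \<bar>v y\<bar> powr (p - 1)\<bar>"
      unfolding abs_mult[symmetric] by linarith
    also have "\<bar>potential U f \<mu> y\<bar> * \<bar>u y - v y\<bar> \<le> norm f * tv_norm U \<mu> * D"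
      by (intro mult_mono V\<mu> elim mult_nonneg_nonneg tv0) auto
    also have "\<bar>potential U f \<mu> y - potential U f \<nu> y\<bar> * \<bar>v y\<bar> \<le> norm f * ?t * R"
      by (intro mult_mono Vd elim mult_nonneg_nonneg tv0) auto
    also have "\<bar>b y\<bar> * \<bar>u y * \<bar>u y\<bar> powr (p - 1) - v y * \<bar>v y\<bar> powr (p - 1)\<bar>
      \<le> Linf_norm U b * (p * R powr (p - 1) * D)"
    proof (intro mult_mono elim B)
      have "\<bar>u y * \<bar>u y\<bar> powr (p - 1) - v y * \<bar>v y\<bar> powr (p - 1)\<bar> \<le> p * R powr (p - 1) * \<bar>u y - v y\<bar>"
        by (rule signed_powr_lipschitz[OF p]) (use elim in auto)
      also have "\<dots> \<le> p * R powr (p - 1) * D" using elim p by (intro mult_left_mono) auto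
      finally show "\<bar>u y * \<bar>u y\<bar> powr (p - 1) - v y * \<bar>v y\<bar> powr (p - 1)\<bar> \<le> p * R powr (p - 1) * D" .
    qed auto
    finally show ?case by (simp add: C_def)
  qed
  \<comment> \<open>Bounds for the separate terms, not just for \<psi>, give the integrability
    needed to split H(\<psi>).\<close>
  have bnd: "AE y in lebesgue_on U. \<bar>potential U f \<rho> y * w y\<bar> \<le> norm f * tv_norm U \<rho> * R"
    if "AE x in lebesgue_on U. \<bar>w x\<bar> \<le> R" "finite_signed_measure U \<rho>" for \<rho> w
    using that(1)
  proof eventually_elim
    case (elim y)
    then show ?case
      unfolding abs_mult by (intro mult_mono potential_bound[OF that(2)] mult_nonneg_nonneg tv0) auto
  qed
  have bndN: "AE y in lebesgue_on U. \<bar>?N w y\<bar> \<le> Linf_norm U b * R * R powr (p - 1)"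
    if "AE x in lebesgue_on U. \<bar>w x\<bar> \<le> R" for w
    using that bB
  proof eventually_elim
    case (elim y)
    then show ?case unfolding abs_mult using p R B by (intro mult_mono mult_nonneg_nonneg) (auto intro!: powr_mono2)
  qed
  have "AE x in lebesgue_on U. \<bar>u x - v x\<bar> \<le> l0 U * C"
  proof -
    have ue: "AE x in lebesgue_on U. u x =
        green_op U g x - green_op U (\<lambda>y. potential U f \<mu> y * u y) x + green_op U (?N u) x"
      and ve: "AE x in lebesgue_on U. v x =
        green_op U g x - green_op U (\<lambda>y. potential U f \<nu> y * v y) x + green_op U (?N v) x"
      using u v by (auto simp: integral_solution_def)
    from ue ve AE_space show ?thesis
    proof eventually_elim
      case (elim x)
      then have x: "x \<in> U" by (simp add: space_restrict_space)
      note i = integrable_green[OF n U(1,2) x]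
      have i1: "integrable (lebesgue_on U) (\<lambda>y. green U x y * (potential U f \<mu> y * u y))"
        by (rule i[OF _ bnd[OF uR \<mu>]]) measurable
      have i2: "integrable (lebesgue_on U) (\<lambda>y. green U x y * (potential U f \<nu> y * v y))"
        by (rule i[OF _ bnd[OF vR \<nu>]]) measurable
      have i3: "integrable (lebesgue_on U) (\<lambda>y. green U x y * ?N u y)"
        by (rule i[OF _ bndN[OF uR]]) measurable
      have i4: "integrable (lebesgue_on U) (\<lambda>y. green U x y * ?N v y)"
        by (rule i[OF _ bndN[OF vR]]) measurable
      have "green_op U \<psi> x = green_op U (\<lambda>y. potential U f \<nu> y * v y) x
          - green_op U (\<lambda>y. potential U f \<mu> y * u y) x + (green_op U (?N u) x - green_op U (?N v) x)"
        unfolding green_op_def \<psi>_def distrib_left right_diff_distrib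
        by (simp only: Bochner_Integration.integral_add Bochner_Integration.integral_diff
            Bochner_Integration.integrable_diff i1 i2 i3 i4)
      then have "u x - v x = green_op U \<psi> x" using elim by simp
      then show ?case using green_op_bound[OF n U(1,2) x \<psi>m \<psi>C C0] by simp
    qed
  qed
  then have "D \<le> l0 U * C"
    unfolding D_def by (intro Linf_norm_le[OF U(1,3)]) measurable
  also have "l0 U * C = (tau U f \<mu> + Kconst U b p * R powr (p - 1)) * D + l0 U * norm f * R * ?t"
    by (simp add: C_def tau_def Kconst_def algebra_simps)
  finally show "Linf_norm U (\<lambda>x. u x - v x) \<le>
      (tau U f \<mu> + Kconst U b p * R powr (p - 1)) * Linf_norm U (\<lambda>x. u x - v x)
      + l0 U * norm f * R * tv_norm U (\<lambda>A. \<mu> A - \<nu> A)"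
    by (simp add: D_def)
qed

lemma abs_Linf_norm_diff_le:
  assumes U: "open U" "U \<noteq> {}" and u: "u \<in> Linf U" and v: "v \<in> Linf U" and d: "(\<lambda>x. u x - v x) \<in> Linf U"
  shows "\<bar>Linf_norm U u - Linf_norm U v\<bar> \<le> Linf_norm U (\<lambda>x. u x - v x)"
proof -
  note AE = AE_le_Linf_norm[OF U u] AE_le_Linf_norm[OF U v] AE_le_Linf_norm[OF U d]
  have "AE x in lebesgue_on U. \<bar>u x\<bar> \<le> Linf_norm U v + Linf_norm U (\<lambda>x. u x - v x)"
    using AE by eventually_elim auto
  from Linf_norm_le[OF U Linf_measurable[OF u] this]
  have 1: "Linf_norm U u \<le> Linf_norm U v + Linf_norm U (\<lambda>x. u x - v x)" .
  have "AE x in lebesgue_on U. \<bar>v x\<bar> \<le> Linf_norm U u + Linf_norm U (\<lambda>x. u x - v x)"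
    using AE by eventually_elim auto
  from Linf_norm_le[OF U Linf_measurable[OF v] this] 1 show ?thesis by auto
qed

text \<open>The bound on v involves \<open>tau\<close> at \<nu> and so varies with \<nu>. A level t
  slightly above \<open>tau\<close> at \<mu> gives one radius R for all \<nu> with
  \<open>tau\<close> at most t, and continuity of q keeps the contraction factor \<open>q t\<close>
  below 1.\<close>

lemma small_solution_norm_locally_lipschitz:
  fixes U :: "'a::euclidean_space set"
  assumes n: "DIM('a) \<ge> 3" and U: "open U" "bounded U" "U \<noteq> {}" and p: "1 < p"
    and b: "b \<in> Linf U" and \<mu>: "finite_signed_measure U \<mu>"
    and ex: "existence_conditions U f b p g \<epsilon> \<mu>"
    and u: "small_solution U f b p g \<epsilon> \<mu> u"
  obtains r L where "0 < r" "0 \<le> L"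
    "\<And>\<nu> v. finite_signed_measure U \<nu> \<Longrightarrow> small_solution U f b p g \<epsilon> \<nu> v \<Longrightarrow>
      tv_norm U (\<lambda>A. \<mu> A - \<nu> A) < r \<Longrightarrow>
      \<bar>Linf_norm U u - Linf_norm U v\<bar> \<le> L * tv_norm U (\<lambda>A. \<mu> A - \<nu> A)"
proof -
  define \<tau> where "\<tau> = tau U f \<mu>"
  define K where "K = Kconst U b p"
  have K: "0 \<le> K" unfolding K_def by (rule Kconst_nonneg[OF n U(1,3) b p])
  have \<epsilon>: "0 < \<epsilon>" and \<tau>: "0 \<le> \<tau>" "\<tau> < 1"
    and c: "2 powr p * K * \<epsilon> powr (p - 1) / (1 - \<tau>) powr (p - 1) + \<tau> < 1"
    using ex by (auto simp: existence_conditions_def \<tau>_def K_def)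
  define q where "q t = \<tau> + K * (2 * \<epsilon> / (1 - t)) powr (p - 1)" for t
  \<comment> \<open>The left side has \<open>2 powr (p - 1)\<close> where the existence condition
    has \<open>2 powr p\<close>, so it is bounded by the first term of that condition.\<close>
  have "K * (2 * \<epsilon> / (1 - \<tau>)) powr (p - 1) = 2 powr (p - 1) * (K * (\<epsilon> powr (p - 1) / (1 - \<tau>) powr (p - 1)))"
    using \<epsilon> \<tau> by (simp add: powr_divide powr_mult)
  also have "\<dots> \<le> 2 powr p * (K * (\<epsilon> powr (p - 1) / (1 - \<tau>) powr (p - 1)))"
    using K by (intro mult_right_mono) auto
  finally have q\<tau>: "q \<tau> < 1" using c by (simp add: q_def)
  have "isCont q \<tau>" unfolding q_def using \<tau> \<epsilon> by (intro continuous_intros) auto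
  then have "((\<lambda>t. q t) \<longlongrightarrow> q \<tau>) (at_right \<tau>)"
    by (simp add: isCont_def filterlim_at_split)
  then have "\<forall>\<^sub>F t in at_right \<tau>. q t < 1" using q\<tau> by (rule order_tendstoD)
  moreover have "\<forall>\<^sub>F t in at_right \<tau>. t < 1" using \<tau>(2) by (rule eventually_at_right_real[THEN eventually_mono]) auto
  moreover have "\<forall>\<^sub>F t in at_right \<tau>. \<tau> < t" by (rule eventually_at_right_less)
  ultimately have "\<forall>\<^sub>F t in at_right \<tau>. q t < 1 \<and> t < 1 \<and> \<tau> < t" by eventually_elim auto
  then obtain t where t: "q t < 1" "t < 1" "\<tau> < t"
    using eventually_happens[of _ "at_right \<tau>"] by auto
  define R where "R = 2 * \<epsilon> / (1 - t)"
  have R: "0 \<le> R" using \<epsilon> t by (simp add: R_def)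
  define l where "l = l0 U * norm f"
  have l: "0 \<le> l" using l0_nonneg[OF n, of U] by (simp add: l_def)
  have R_le: "2 * \<epsilon> / (1 - s) \<le> R" if "s \<le> t" for s
    unfolding R_def using that t \<epsilon> by (intro divide_left_mono) auto
  \<comment> \<open>Within this distance \<open>tau\<close> changes by at most t - \<tau>; the
    summand 1 avoids division by 0 when l = 0.\<close>
  define r where "r = (t - \<tau>) / (l + 1)"
  \<comment> \<open>Obtained by solving D \<le> \<open>q t * D + l * R * ?d\<close> for D.\<close>
  define L where "L = l * R / (1 - q t)"
  show ?thesis
  proof (rule that[of r L])
    show "0 < r" using t l by (simp add: r_def)
    show "0 \<le> L" using t l R by (simp add: L_def)
  next
    fix \<nu> v
    assume \<nu>: "finite_signed_measure U \<nu>" and v: "small_solution U f b p g \<epsilon> \<nu> v"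
      and near: "tv_norm U (\<lambda>A. \<mu> A - \<nu> A) < r"
    let ?d = "tv_norm U (\<lambda>A. \<mu> A - \<nu> A)"
    have d0: "0 \<le> ?d" by (simp add: tv_norm_def)
    have "tv_norm U \<nu> \<le> tv_norm U \<mu> + ?d"
      using tv_norm_triangle[OF \<mu> finite_signed_measure_diff[OF \<nu> \<mu>]]
      by (simp add: tv_norm_diff_commute[of U \<nu> \<mu>])
    then have "tau U f \<nu> \<le> \<tau> + l * ?d"
      unfolding tau_def \<tau>_def using l by (simp add: l_def[symmetric] mult_left_mono flip: distrib_left)
    also have "l * ?d \<le> (l + 1) * ?d" using d0 by (simp add: distrib_right)
    also have "(l + 1) * ?d \<le> t - \<tau>" using near l by (simp add: r_def field_simps)
    finally have \<tau>\<nu>: "tau U f \<nu> \<le> t" by simp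
    have uR: "Linf_norm U u \<le> R"
      using u R_le[of \<tau>] t by (auto simp: small_solution_def \<tau>_def)
    have vR: "Linf_norm U v \<le> R"
      using v R_le[OF \<tau>\<nu>] by (auto simp: small_solution_def)
    have us: "integral_solution U f b p g \<mu> u" and vs: "integral_solution U f b p g \<nu> v"
      using u v by (auto simp: small_solution_def)
    define D where "D = Linf_norm U (\<lambda>x. u x - v x)"
    note est = integral_solution_diff_estimate[OF n U p b \<mu> \<nu> us uR vs vR]
    have "D \<le> q t * D + l * R * ?d"
      using est(2) by (simp add: D_def q_def \<tau>_def K_def l_def R_def)
    then have "D \<le> L * ?d" using t by (simp add: L_def field_simps)
    moreover have "\<bar>Linf_norm U u - Linf_norm U v\<bar> \<le> D"
      unfolding D_def
      by (rule abs_Linf_norm_diff_le[OF U(1,3) _ _ est(1)]) (use us vs in \<open>auto simp: integral_solution_def\<close>)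
    ultimately show "\<bar>Linf_norm U u - Linf_norm U v\<bar> \<le> L * ?d" by simp
  qed
qed

section \<open>I.i.d. sequences and the central limit theorem\<close>

text \<open>One W serves every j. Events of \<open>Z j\<close> are then events of
  \<open>X j\<close>, which yields measurability and independence, and the common W has the same
  probability under each \<open>X j\<close>, which yields equal laws.\<close>

lemma iid_sequence_transfer:
  assumes P: "prob_space P" and iid: "iid_sequence P N X"
    and tr: "\<And>C. C \<in> sets M \<Longrightarrow> \<exists>W\<in>sets N. \<forall>j. \<forall>\<omega>\<in>space P. Z j \<omega> \<in> C \<longleftrightarrow> X j \<omega> \<in> W"
    and Zs: "\<And>j \<omega>. \<omega> \<in> space P \<Longrightarrow> Z j \<omega> \<in> space M"
  shows "iid_sequence P M Z"
proof -
  interpret prob_space P by (rule P)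
  have ind: "indep_vars (\<lambda>_. N) X UNIV" and dis: "\<And>i j. distr P N (X i) = distr P N (X j)"
    using iid by (auto simp: iid_sequence_def)
  have Xm: "X j \<in> measurable P N" for j using ind by (auto simp: indep_vars_def2)
  have pre: "\<exists>W\<in>sets N. \<forall>j. Z j -` C \<inter> space P = X j -` W \<inter> space P" if "C \<in> sets M" for C
    using tr[OF that] by (auto simp: set_eq_iff)
  have Zm: "Z j \<in> measurable P M" for j
  proof (rule measurableI)
    fix C assume "C \<in> sets M"
    from pre[OF this] obtain W
      where "W \<in> sets N" "Z j -` C \<inter> space P = X j -` W \<inter> space P" by (elim bexE allE[of _ j])
    then show "Z j -` C \<inter> space P \<in> sets P" using measurable_sets[OF Xm] by simp
  qed (rule Zs)
  have "indep_sets (\<lambda>i. {X i -` A \<inter> space P | A. A \<in> sets N}) UNIV"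
    using ind by (simp add: indep_vars_def2)
  then have "indep_sets (\<lambda>i. {Z i -` A \<inter> space P | A. A \<in> sets M}) UNIV"
  proof (rule indep_sets_mono_sets)
    fix i
    show "{Z i -` A \<inter> space P | A. A \<in> sets M} \<subseteq> {X i -` A \<inter> space P | A. A \<in> sets N}"
    proof
      fix S assume "S \<in> {Z i -` A \<inter> space P | A. A \<in> sets M}"
      then obtain A where A: "A \<in> sets M" "S = Z i -` A \<inter> space P" by blast
      from pre[OF A(1)] obtain W where "W \<in> sets N" "S = X i -` W \<inter> space P"
        unfolding A(2) by (elim bexE allE[of _ i])
      then show "S \<in> {X i -` A \<inter> space P | A. A \<in> sets N}" by blast
    qed
  qed
  then have "indep_vars (\<lambda>_. M) Z UNIV" using Zm by (simp add: indep_vars_def2)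
  moreover have "distr P M (Z i) = distr P M (Z j)" for i j
  proof (rule measure_eqI)
    fix C assume "C \<in> sets (distr P M (Z i))"
    then have C: "C \<in> sets M" by simp
    from pre[OF this] obtain W
      where W: "W \<in> sets N" "\<And>j. Z j -` C \<inter> space P = X j -` W \<inter> space P" by (elim bexE) simp
    have "emeasure (distr P M (Z k)) C = emeasure (distr P N (X k)) W" for k
      using C W by (simp add: emeasure_distr Zm Xm)
    then show "emeasure (distr P M (Z i)) C = emeasure (distr P M (Z j)) C" using dis[of i j] by simp
  qed simp
  ultimately show ?thesis by (simp add: iid_sequence_def)
qed

text \<open>The sets C that admit such a W form a \<sigma>-algebra; complements use that X takes
  values in \<open>space N\<close>.\<close>

lemma borel_preimage_of_open_preimage:
  fixes Z :: "'i \<Rightarrow> 'w \<Rightarrow> 'b::topological_space"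
  assumes op: "\<And>C. open C \<Longrightarrow> \<exists>W\<in>sets N. \<forall>j. \<forall>\<omega>\<in>S. Z j \<omega> \<in> C \<longleftrightarrow> X j \<omega> \<in> W"
    and X: "\<And>j \<omega>. \<omega> \<in> S \<Longrightarrow> X j \<omega> \<in> space N"
    and C: "C \<in> sets borel"
  shows "\<exists>W\<in>sets N. \<forall>j. \<forall>\<omega>\<in>S. Z j \<omega> \<in> C \<longleftrightarrow> X j \<omega> \<in> W"
proof -
  from C have "C \<in> sigma_sets UNIV {C. open C}" by (simp add: borel_def)
  then show ?thesis
  proof induction
    case (Basic C)
    then show ?case using op by simp
  next
    case Empty
    then show ?case by (intro bexI[of _ "{}"]) auto
  next
    case (Compl C)
    then obtain W where "W \<in> sets N" "\<forall>j. \<forall>\<omega>\<in>S. Z j \<omega> \<in> C \<longleftrightarrow> X j \<omega> \<in> W" by blast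
    then show ?case using X by (intro bexI[of _ "space N - W"]) auto
  next
    case (Union C)
    then obtain W where "\<And>i. W i \<in> sets N" "\<And>i. \<forall>j. \<forall>\<omega>\<in>S. Z j \<omega> \<in> C i \<longleftrightarrow> X j \<omega> \<in> W i" by metis
    then show ?case by (intro bexI[of _ "\<Union>i. W i"]) auto
  qed
qed

text \<open>The normal law has no atoms, so weak convergence gives convergence of the distribution
  functions at every real x.\<close>

lemma
  shows isCont_cdf_std_normal: "isCont (cdf std_normal_distribution) x"
    and cdf_std_normal: "cdf std_normal_distribution x
      = 1 / sqrt (2 * pi) * (LBINT t:{..x}. exp (- (t\<^sup>2 / 2)))"
proof -
  interpret real_distribution std_normal_distribution by (rule real_dist_normal_dist)
  have "emeasure std_normal_distribution {x} = 0"
  proof -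
    have "AE t in lborel. t \<noteq> x" by (rule AE_lborel_singleton)
    then show ?thesis
      by (subst emeasure_density) (auto simp: nn_integral_0_iff_AE elim!: eventually_mono)
  qed
  then show "isCont (cdf std_normal_distribution) x" by (simp add: isCont_cdf measure_def)
  have "cdf std_normal_distribution x = (\<integral>t. indicator {..x} t \<partial>std_normal_distribution)"
    by (simp add: cdf_def)
  also have "\<dots> = (\<integral>t. std_normal_density t *\<^sub>R indicator {..x} t \<partial>lborel)"
    by (rule integral_density) auto
  also have "\<dots> = (\<integral>t. 1 / sqrt (2 * pi) * (indicator {..x} t *\<^sub>R exp (- (t\<^sup>2 / 2))) \<partial>lborel)"
    by (rule Bochner_Integration.integral_cong) (auto simp: std_normal_density_def)
  also have "\<dots> = 1 / sqrt (2 * pi) * (LBINT t:{..x}. exp (- (t\<^sup>2 / 2)))"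
    unfolding set_lebesgue_integral_def by (rule integral_mult_right_zero)
  finally show "cdf std_normal_distribution x
      = 1 / sqrt (2 * pi) * (LBINT t:{..x}. exp (- (t\<^sup>2 / 2)))" .
qed

lemma iid_central_limit_theorem:
  fixes Z :: "nat \<Rightarrow> 'w \<Rightarrow> real"
  assumes P: "prob_space P" and iid: "iid_sequence P borel Z"
    and m: "m = prob_space.expectation P (Z i)"
    and sq: "integrable P (\<lambda>\<omega>. (Z i \<omega>)\<^sup>2)"
    and s2: "\<sigma>\<^sup>2 = prob_space.variance P (Z i)" and \<sigma>: "0 < \<sigma>"
  shows "tends_to_std_normal P (\<lambda>k \<omega>. \<Sum>j<k. (Z j \<omega> - m) / (\<sigma> * sqrt (real k)))"
proof -
  interpret prob_space P by (rule P)
  have ind: "indep_vars (\<lambda>_. borel) Z UNIV" and dis: "\<And>j. distr P borel (Z j) = distr P borel (Z i)"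
    using iid by (auto simp: iid_sequence_def)
  have Zm[measurable]: "Z j \<in> borel_measurable P" for j using ind by (auto simp: indep_vars_def2)
  \<comment> \<open>Moments are assumed for the index i alone; equal laws carry them to every
    j.\<close>
  have E: "expectation (\<lambda>\<omega>. h (Z j \<omega>)) = expectation (\<lambda>\<omega>. h (Z i \<omega>))"
    if [measurable]: "h \<in> borel_measurable borel" for h :: "real \<Rightarrow> real" and j
    using integral_distr[OF Zm[of j] that] integral_distr[OF Zm[of i] that] dis[of j] by simp
  have mj: "expectation (Z j) = m" for j using E[of "\<lambda>x. x" j] m by simp
  have sqj: "integrable P (\<lambda>\<omega>. (Z j \<omega>)\<^sup>2)" for j
  proof -
    have "integrable (distr P borel (Z i)) (\<lambda>x. x\<^sup>2)" using sq by (simp add: integrable_distr_eq)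
    then have "integrable (distr P borel (Z j)) (\<lambda>x. x\<^sup>2)" by (simp add: dis[of j])
    then show ?thesis by (simp add: integrable_distr_eq)
  qed
  have vj: "variance (Z j) = \<sigma>\<^sup>2" for j
    using E[of "\<lambda>x. (x - m)\<^sup>2" j] s2 by (simp add: mj)
  have "weak_conv_m (\<lambda>n. distr P borel (\<lambda>x. (\<Sum>j<n. Z j x - m) / sqrt (n * \<sigma>\<^sup>2))) std_normal_distribution"
    by (rule central_limit_theorem[OF ind mj \<sigma> sqj vj dis])
  then have lim: "(\<lambda>n. cdf (distr P borel (\<lambda>x. (\<Sum>j<n. Z j x - m) / sqrt (n * \<sigma>\<^sup>2))) x)
      \<longlonglongrightarrow> cdf std_normal_distribution x" for x
    by (simp add: weak_conv_m_def weak_conv_def isCont_cdf_std_normal)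
  have "cdf (distr P borel (\<lambda>x. (\<Sum>j<n. Z j x - m) / sqrt (n * \<sigma>\<^sup>2))) x =
      measure P {\<omega> \<in> space P. (\<Sum>j<n. (Z j \<omega> - m) / (\<sigma> * sqrt (real n))) \<le> x}" for n x
  proof -
    have "sqrt (n * \<sigma>\<^sup>2) = \<sigma> * sqrt (real n)" using \<sigma> by (simp add: real_sqrt_mult)
    then show ?thesis
      unfolding cdf_def
      by (subst measure_distr) (auto simp: sum_divide_distrib intro!: arg_cong[where f = "measure P"])
  qed
  with lim show ?thesis by (simp add: tends_to_std_normal_def cdf_std_normal)
qed

text \<open>W is the largest open set whose realized measures all have norm in C. The local
  Lipschitz bound puts a whole ball around each realized measure with norm in C into W, so nothing
  is asked of measures that are not realized.\<close>

lemma open_preimage_Linf_norm_small_solution: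
  fixes U :: "'a::euclidean_space set" and X :: "'i \<Rightarrow> 'w \<Rightarrow> 'a set \<Rightarrow> real"
  assumes n: "DIM('a) \<ge> 3" and U: "open U" "bounded U" "U \<noteq> {}" and p: "1 < p" and b: "b \<in> Linf U"
    and X: "\<And>j \<omega>. \<omega> \<in> S \<Longrightarrow> X j \<omega> \<in> radon_measures U"
    and ex: "\<And>j \<omega>. \<omega> \<in> S \<Longrightarrow> existence_conditions U f b p g \<epsilon> (X j \<omega>)"
    and u: "\<And>j \<omega>. \<omega> \<in> S \<Longrightarrow> small_solution U f b p g \<epsilon> (X j \<omega>) (u j \<omega>)"
    and C: "open C"
  shows "\<exists>W\<in>sets (radon_borel U). \<forall>j. \<forall>\<omega>\<in>S. Linf_norm U (u j \<omega>) \<in> C \<longleftrightarrow> X j \<omega> \<in> W"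
proof -
  interpret M: Metric_space "radon_measures U" "\<lambda>\<mu> \<nu>. tv_norm U (\<lambda>A. \<mu> A - \<nu> A)"
    by (rule Metric_space_radon_measures)
  define W where "W = \<Union>{B. openin M.mtopology B \<and>
    (\<forall>i. \<forall>\<omega>\<in>S. X i \<omega> \<in> B \<longrightarrow> Linf_norm U (u i \<omega>) \<in> C)}"
  have "openin M.mtopology W" unfolding W_def by (rule openin_Union) auto
  then have "W \<in> sets (radon_borel U)"
    unfolding radon_borel_def using openin_subset[of M.mtopology]
    by (subst sets_measure_of) (auto intro!: sigma_sets.Basic)
  moreover have "X j \<omega> \<in> W" if \<omega>: "\<omega> \<in> S" and Z: "Linf_norm U (u j \<omega>) \<in> C" for j \<omega>
  proof -
    obtain e where e: "e > 0" "ball (Linf_norm U (u j \<omega>)) e \<subseteq> C" using C Z by (meson openE)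
    obtain r L where r: "0 < r" "0 \<le> L" and
      L: "\<And>\<nu> v. finite_signed_measure U \<nu> \<Longrightarrow> small_solution U f b p g \<epsilon> \<nu> v \<Longrightarrow>
        tv_norm U (\<lambda>A. X j \<omega> A - \<nu> A) < r \<Longrightarrow>
        \<bar>Linf_norm U (u j \<omega>) - Linf_norm U v\<bar> \<le> L * tv_norm U (\<lambda>A. X j \<omega> A - \<nu> A)"
      using small_solution_norm_locally_lipschitz[OF n U p b
          radon_imp_finite_signed_measure[OF X[OF \<omega>]] ex[OF \<omega>] u[OF \<omega>]] by blast
    \<comment> \<open>Keeps \<open>L * ?d\<close> below e; \<open>L + 1\<close> also covers L =
      0.\<close>
    define s where "s = min r (e / (L + 1))"
    have s: "0 < s" using r e by (simp add: s_def)
    have "Linf_norm U (u i \<omega>') \<in> C" if \<omega>': "\<omega>' \<in> S" and B: "X i \<omega>' \<in> M.mball (X j \<omega>) s" for i \<omega>'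
    proof -
      let ?d = "tv_norm U (\<lambda>A. X j \<omega> A - X i \<omega>' A)"
      have d: "?d < s" using B by (simp add: M.in_mball)
      have "\<bar>Linf_norm U (u j \<omega>) - Linf_norm U (u i \<omega>')\<bar> \<le> L * ?d"
        by (rule L[OF radon_imp_finite_signed_measure[OF X[OF \<omega>']] u[OF \<omega>']])
          (use d in \<open>auto simp: s_def\<close>)
      also have "\<dots> \<le> (L + 1) * ?d" by (simp add: distrib_right tv_norm_def)
      also have "\<dots> < (L + 1) * (e / (L + 1))"
        using d r by (intro mult_strict_left_mono) (auto simp: s_def)
      also have "\<dots> = e" using r by simp
      finally show ?thesis using e(2) by (auto simp: dist_real_def)
    qed
    then have "M.mball (X j \<omega>) s \<subseteq> W"
      unfolding W_def by (intro Union_upper) auto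
    moreover have "X j \<omega> \<in> M.mball (X j \<omega>) s" by (rule M.centre_in_mball_iff[THEN iffD2]) (use X[OF \<omega>] s in auto)
    ultimately show ?thesis by blast
  qed
  moreover have "Linf_norm U (u j \<omega>) \<in> C" if "\<omega> \<in> S" "X j \<omega> \<in> W" for j \<omega>
    using that by (auto simp: W_def)
  ultimately show ?thesis by blast
qed

theorem theorem3p6:
  fixes P :: "'w measure"
    and U :: "'a::euclidean_space set"
    and f :: "'a \<Rightarrow>\<^sub>C real"
    and b g :: "'a \<Rightarrow> real"
    and p c\<^sub>0 K \<epsilon>\<^sub>0 :: real
    and X :: "nat \<Rightarrow> 'w \<Rightarrow> 'a set \<Rightarrow> real"
    and u :: "nat \<Rightarrow> 'w \<Rightarrow> 'a \<Rightarrow> real"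
    and Z :: "nat \<Rightarrow> 'w \<Rightarrow> real"
  assumes "prob_space P" and "complete_measure P"
    and "DIM('a) \<ge> 3" and "p > 1"
    and "open U" and "connected U" and "U \<noteq> {}" and "bounded U"
    and "b \<in> Linf U" and "g \<in> Linf U"
    and "K = Kconst U b p"
    and "Linf_norm U g < 1 / l0 U * (1 / (2 powr p * K)) powr (1 / (p - 1))"
    and "0 < c\<^sub>0" and "c\<^sub>0 < 1"
    and "\<epsilon>\<^sub>0 = ((1 - c\<^sub>0) powr p / (2 powr p * K)) powr (1 / (p - 1))"
    and "iid_sequence P (radon_borel U) X"
    and "\<And>j. admissible_set P U f b p g \<epsilon>\<^sub>0 (X j) = space P"
    and "\<And>j \<omega>. \<omega> \<in> space P \<Longrightarrow> small_solution U f b p g \<epsilon>\<^sub>0 (X j \<omega>) (u j \<omega>)"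
    and "Z = (\<lambda>j \<omega>. Linf_norm U (u j \<omega>))"
  shows "iid_sequence P borel Z \<and>
    (\<forall>i m \<sigma>. integrable P (Z i) \<and> m = prob_space.expectation P (Z i) \<and>
       integrable P (\<lambda>\<omega>. (Z i \<omega>)\<^sup>2) \<and> \<sigma>\<^sup>2 = prob_space.variance P (Z i) \<and> 0 < \<sigma> \<longrightarrow>
       tends_to_std_normal P (\<lambda>k \<omega>. \<Sum>j<k. (Z j \<omega> - m) / (\<sigma> * sqrt (real k))))"
proof -
  have ind: "prob_space.indep_vars P (\<lambda>_. radon_borel U) X UNIV"
    using \<open>iid_sequence P (radon_borel U) X\<close> by (simp add: iid_sequence_def)
  have sp: "space (radon_borel U) = radon_measures U"
    by (simp add: radon_borel_def space_measure_of_conv)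
  have Xr: "X j \<omega> \<in> space (radon_borel U)" if "\<omega> \<in> space P" for j \<omega>
    using ind that measurable_space[of "X j" P "radon_borel U"]
    by (auto simp: prob_space.indep_vars_def2[OF \<open>prob_space P\<close>])
  have ex: "existence_conditions U f b p g \<epsilon>\<^sub>0 (X j \<omega>)" if "\<omega> \<in> space P" for j \<omega>
    using assms(17)[of j] that by (auto simp: admissible_set_def)
  have op: "\<exists>W\<in>sets (radon_borel U). \<forall>j. \<forall>\<omega>\<in>space P. Z j \<omega> \<in> C \<longleftrightarrow> X j \<omega> \<in> W" if "open C" for C
    unfolding \<open>Z = _\<close>
    by (rule open_preimage_Linf_norm_small_solution[OF \<open>DIM('a) \<ge> 3\<close> \<open>open U\<close> \<open>bounded U\<close> \<open>U \<noteq> {}\<close>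
          \<open>p > 1\<close> \<open>b \<in> Linf U\<close> Xr[unfolded sp] ex assms(18) that])
  have iid: "iid_sequence P borel Z"
    by (rule iid_sequence_transfer[OF \<open>prob_space P\<close> \<open>iid_sequence P (radon_borel U) X\<close>
          borel_preimage_of_open_preimage[OF op Xr]]) auto
  then show ?thesis
    using iid_central_limit_theorem[OF \<open>prob_space P\<close> iid] by blast
qed

end
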